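(* Let $K$ be a real quadratic field and $f$ a positive integer, with notation as below. The following are equivalent: (1) $\mathcal{U}_f$ contains a unit of norm $-1$; (2) $d_1-3$ is a perfect square, $j_{\min}(f)$ is odd, and the integer $\sqrt{\frac{d_{j_{\min}(f)}+1}{\Delta_0}}=\frac{f_{j_{\min}(f)}}{\sqrt{d_{j_{\min}(f)}-3}}$ is divisible by $f$. In that case, $\mathcal{U}_f=\{\pm u^{\,n\,j_{\min}(f)}: n\in\mathbb{Z}\}$.
   Context: Let $K\subset\mathbb{R}$ be a real quadratic field of discriminant $\Delta_0$; let $u$ be the smallest unit of $K$ greater than $1$ (the fundamental unit), and $\varepsilon$ the smallest unit of $K$ of norm $+1$ greater than $1$. For positive integers $j$ set $f_j=(\varepsilon^j-\varepsilon^{-j})/\sqrt{\Delta_0}$ and $d_j=\varepsilon^j+\varepsilon^{-j}+1$ (both integers). For a positive integer $f$, $\mathcal{O}_f=\{m+nf\frac{\Delta_0+\sqrt{\Delta_0}}{2}: m,n\in\mathbb{Z}\}$ is the order of conductor $f$, $\mathcal{U}_f=\mathcal{O}_f^\times$ is its unit group, and $j_{\min}(f)=\min\{j\ge1: f\mid f_j\}$ (this minimum exists). *)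

theory Defs
  imports
    "HOL-Analysis.Analysis"
    "HOL-Computational_Algebra.Computational_Algebra"
begin

definition real_subfield :: "real set \<Rightarrow> bool" where
  "real_subfield K \<longleftrightarrow>
     1 \<in> K \<and> (\<forall>x\<in>K. \<forall>y\<in>K. x - y \<in> K \<and> x * y \<in> K) \<and> (\<forall>x\<in>K. inverse x \<in> K)"

definition rat_dim :: "real set \<Rightarrow> nat" where
  "rat_dim = vector_space.dim (\<lambda>(q::rat) (x::real). of_rat q * x)"

definition real_quadratic_field :: "real set \<Rightarrow> bool" where
  "real_quadratic_field K \<longleftrightarrow> real_subfield K \<and> rat_dim K = 2"

text \<open>
  Automorphisms are functions on \<open>K\<close>, made unique as total functions by \<open>extensional K\<close>.
  They fix the rationals automatically, and a quadratic field is Galois over the rationals,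
  so norm and trace are the product and the sum over this group.
\<close>

definition field_auts :: "real set \<Rightarrow> (real \<Rightarrow> real) set" where
  "field_auts K = {\<sigma> \<in> extensional K. bij_betw \<sigma> K K \<and>
     (\<forall>x\<in>K. \<forall>y\<in>K. \<sigma> (x + y) = \<sigma> x + \<sigma> y \<and> \<sigma> (x * y) = \<sigma> x * \<sigma> y)}"

definition field_norm :: "real set \<Rightarrow> real \<Rightarrow> real" where
  "field_norm K x = (\<Prod>\<sigma>\<in>field_auts K. \<sigma> x)"

definition field_trace :: "real set \<Rightarrow> real \<Rightarrow> real" where
  "field_trace K x = (\<Sum>\<sigma>\<in>field_auts K. \<sigma> x)"

definition ring_of_integers :: "real set \<Rightarrow> real set" where
  "ring_of_integers K = {x \<in> K. algebraic_int x}"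

definition units_in :: "real set \<Rightarrow> real set" where
  "units_in R = {x \<in> R. \<exists>y\<in>R. x * y = 1}"

definition integral_basis :: "real set \<Rightarrow> real \<Rightarrow> real \<Rightarrow> bool" where
  "integral_basis K \<alpha> \<beta> \<longleftrightarrow>
     bij_betw (\<lambda>(m::int, n::int). of_int m * \<alpha> + of_int n * \<beta>) UNIV (ring_of_integers K)"

text \<open>The determinant of the trace form on an integral basis, which is independent of the basis.\<close>

definition field_disc :: "real set \<Rightarrow> int" where
  "field_disc K = (THE \<Delta>. \<exists>\<alpha> \<beta>. integral_basis K \<alpha> \<beta> \<and>
     of_int \<Delta> = field_trace K (\<alpha> * \<alpha>) * field_trace K (\<beta> * \<beta>) - (field_trace K (\<alpha> * \<beta>))\<^sup>2)"

definition fund_unit :: "real set \<Rightarrow> real" where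
  "fund_unit K = (LEAST x. x \<in> units_in (ring_of_integers K) \<and> x > 1)"

definition pos_fund_unit :: "real set \<Rightarrow> real" where
  "pos_fund_unit K = (LEAST x. x \<in> units_in (ring_of_integers K) \<and> field_norm K x = 1 \<and> x > 1)"

definition f_seq :: "real set \<Rightarrow> nat \<Rightarrow> real" where
  "f_seq K j = (pos_fund_unit K ^ j - inverse (pos_fund_unit K) ^ j) / sqrt (of_int (field_disc K))"

definition d_seq :: "real set \<Rightarrow> nat \<Rightarrow> real" where
  "d_seq K j = pos_fund_unit K ^ j + inverse (pos_fund_unit K) ^ j + 1"

text \<open>
  Divisibility and being a perfect square are meant in the integers; the numbers they are
  applied to are given by real-valued formulas, and both predicates entail integrality.
\<close>

definition nat_divides :: "nat \<Rightarrow> real \<Rightarrow> bool" where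
  "nat_divides f x \<longleftrightarrow> (\<exists>k::int. x = of_int k \<and> int f dvd k)"

definition perfect_square :: "real \<Rightarrow> bool" where
  "perfect_square x \<longleftrightarrow> (\<exists>k::int. x = of_int k \<and> is_square k)"

definition quad_order :: "real set \<Rightarrow> nat \<Rightarrow> real set" where
  "quad_order K f =
     {of_int m + of_int n * of_nat f * ((of_int (field_disc K) + sqrt (of_int (field_disc K))) / 2)
      | (m::int) (n::int). True}"

definition order_units :: "real set \<Rightarrow> nat \<Rightarrow> real set" where
  "order_units K f = units_in (quad_order K f)"

definition j_min :: "real set \<Rightarrow> nat \<Rightarrow> nat" where
  "j_min K f = (LEAST j. j \<ge> 1 \<and> nat_divides f (f_seq K j))"

end

theory Submission
  imports Defs
begin

text \<open>
  Write \<open>x'\<close> for the conjugate of \<open>x\<close>. An algebraic integer \<open>x\<close> of \<open>K\<close> lies in the order of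
  conductor \<open>f\<close> iff \<open>f\<close> divides the integer \<open>(x - x') / sqrt \<Delta>\<close>, and the units of the maximal order
  are the \<open>\<plusminus>u\<^sup>n\<close>. The number \<open>d\<^sub>1 - 3 = (sqrt \<epsilon> - 1 / sqrt \<epsilon>)\<^sup>2\<close> is a square iff
  \<open>sqrt \<epsilon>\<close> is a unit of norm \<open>-1\<close>, that is, iff \<open>u\<close> has norm \<open>-1\<close> and \<open>\<epsilon> = u\<^sup>2\<close>. In that case
  \<open>f\<^sub>j\<close> is the coordinate of \<open>u\<^sup>2\<^sup>j\<close> and, for odd \<open>j\<close>, \<open>sqrt ((d\<^sub>j + 1) / \<Delta>)\<close> is that of \<open>u\<^sup>j\<close>.
  The exponents \<open>n\<close> with \<open>u\<^sup>n\<close> in the order form a subgroup \<open>m\<int>\<close>; it contains an odd number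
  iff \<open>m\<close> is odd, and then \<open>m = j\<^sub>m\<^sub>i\<^sub>n(f)\<close>.
\<close>

section \<open>Quadratic irrationals and Pell's equation\<close>

lemma irrational_linear_eq_0:
  fixes t a b :: real
  assumes "t \<notin> \<rat>" "a \<in> \<rat>" "b \<in> \<rat>" "a + b * t = 0"
  shows "a = 0 \<and> b = 0"
proof (cases "b = 0")
  case False
  then have "t = - a / b" using assms(4) by (simp add: field_simps)
  then show ?thesis using assms(1-3) by simp
qed (use assms in simp)

lemma irrational_linear_inject:
  fixes t a b c d :: real
  assumes "t \<notin> \<rat>" "a \<in> \<rat>" "b \<in> \<rat>" "c \<in> \<rat>" "d \<in> \<rat>" "a + b * t = c + d * t"
  shows "a = c \<and> b = d"
  using irrational_linear_eq_0[of t "a - c" "b - d"] assms by (auto simp: algebra_simps)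

text \<open>Gauss's lemma in disguise: a primitive integer multiple \<open>Q\<close> of
  \<open>X^2 - t X + n\<close> divides an integer multiple of a monic \<open>P\<close> with root
  \<open>x\<close>, and comparing contents and leading coefficients makes the leading coefficient of
  \<open>Q\<close> a unit.\<close>

lemma quadratic_algebraic_int_coeffs:
  fixes x t n :: real
  assumes x: "x \<notin> \<rat>" "algebraic_int x" and tn: "t \<in> \<rat>" "n \<in> \<rat>" "x\<^sup>2 = t * x - n"
  shows "t \<in> \<int>" "n \<in> \<int>"
proof -
  obtain P :: "int poly" where P: "poly (map_poly of_int P) x = 0" "lead_coeff P = 1"
    using x(2) unfolding algebraic_int_altdef_ipoly by blast
  have ev: "poly (map_poly of_int (p + q)) x = poly (map_poly of_int p) x + poly (map_poly of_int q) x"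
    "poly (map_poly of_int (smult c p)) x = of_int c * poly (map_poly of_int p) x"
    "poly (map_poly of_int (p * q)) x = poly (map_poly of_int p) x * poly (map_poly of_int q) x"
    for p q :: "int poly" and c
  proof -
    have "map_poly of_int (p + q) = (map_poly of_int p + map_poly of_int q :: real poly)"
      "map_poly of_int (smult c p) = (smult (of_int c) (map_poly of_int p) :: real poly)"
      "map_poly of_int (p * q) = (map_poly of_int p * map_poly of_int q :: real poly)"
      by (simp_all add: poly_eq_iff coeff_map_poly coeff_mult)
    then show "poly (map_poly of_int (p + q)) x = poly (map_poly of_int p) x + poly (map_poly of_int q) x"
      "poly (map_poly of_int (smult c p)) x = of_int c * poly (map_poly of_int p) x"
      "poly (map_poly of_int (p * q)) x = poly (map_poly of_int p) x * poly (map_poly of_int q) x"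
      by simp_all
  qed
  obtain t1 t2 :: int where t: "t2 > 0" "t = of_int t1 / of_int t2" using tn(1) by (auto elim: Rats_cases')
  obtain n1 n2 :: int where n: "n2 > 0" "n = of_int n1 / of_int n2" using tn(2) by (auto elim: Rats_cases')
  \<comment> \<open>\<open>Q0\<close> is \<open>X^2 - t X + n\<close> times the common denominator
    \<open>t2 * n2\<close>; dividing by its content makes it primitive.\<close>
  define Q0 where "Q0 = [: n1 * t2, - (t1 * n2), t2 * n2 :]"
  have Q0: "Q0 \<noteq> 0" "degree Q0 = 2" using t n by (auto simp: Q0_def)
  define Q where "Q = primitive_part Q0"
  have Q: "Q \<noteq> 0" "degree Q = 2" "content Q = 1" using Q0 by (auto simp: Q_def)
  have Qx: "poly (map_poly of_int Q) x = 0"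
  proof -
    have e: "of_int n1 = n * of_int n2" "of_int t1 = t * of_int t2" using t n by simp_all
    have "poly (map_poly of_int Q0) x = t2 * n2 * (n - t * x + x\<^sup>2)"
      unfolding Q0_def by (simp add: map_poly_pCons e algebra_simps power2_eq_square)
    then have "poly (map_poly of_int Q0) x = 0" using tn(3) by simp
    moreover have "poly (map_poly of_int Q0) x = of_int (content Q0) * poly (map_poly of_int Q) x"
      using ev(2)[of "content Q0" Q] unfolding Q_def by simp
    ultimately show ?thesis using Q0 by simp
  qed
  \<comment> \<open>Pseudo-division stays inside the integer polynomials at the price of a factor
    \<open>c\<close> on \<open>P\<close>. The remainder is at most linear and vanishes at the
    irrational \<open>x\<close>, so it is zero.\<close>
  obtain c S where cS: "c \<noteq> 0" "smult c P = Q * S + pseudo_mod P Q" and dR: "pseudo_mod P Q = 0 \<or> degree (pseudo_mod P Q) < 2"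
    using pseudo_mod[of Q P] Q by auto
  have R0: "pseudo_mod P Q = 0"
  proof -
    define R where "R = pseudo_mod P Q"
    obtain r0 r1 where R: "R = [:r0, r1:]"
    proof -
      have "degree R < 2" using dR by (auto simp: R_def)
      then have "R = [:coeff R 0, coeff R 1:]"
        by (auto simp: poly_eq_iff coeff_pCons coeff_eq_0 split: nat.splits)
      then show ?thesis by (rule that)
    qed
    have "poly (map_poly of_int (smult c P)) x = poly (map_poly of_int (Q * S + R)) x"
      using cS R_def by simp
    then have "of_int r0 + of_int r1 * x = 0"
      unfolding ev using P Qx by (simp add: R map_poly_pCons mult.commute)
    then have "r0 = 0 \<and> r1 = 0" using irrational_linear_eq_0[OF x(1), of "of_int r0" "of_int r1"] by simp
    then show ?thesis using R R_def by simp
  qed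
  \<comment> \<open>\<open>P\<close> is monic and \<open>Q\<close> primitive, so multiplicativity of
    the content leaves \<open>\<bar>c\<bar>\<close> as the content of \<open>S\<close>. Hence
    \<open>\<bar>c\<bar>\<close> divides the leading coefficient of \<open>S\<close> and cancels
    from the comparison of leading coefficients.\<close>
  have "content P dvd lead_coeff P" by (rule content_dvd_coeff)
  then have "content P = 1" using P(2) normalize_content[of P] by simp
  then have "content S = \<bar>c\<bar>"
    using arg_cong[OF cS(2), of content] R0 Q(3) by (simp add: content_mult)
  then obtain l where l: "lead_coeff S = \<bar>c\<bar> * l" using content_dvd_coeff[of S "degree S"] by (metis dvdE)
  have "c = lead_coeff Q * (\<bar>c\<bar> * l)"
    using arg_cong[OF cS(2), of lead_coeff] R0 P(2) l cS(1) by (simp add: lead_coeff_mult)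
  then have "\<bar>c\<bar> * \<bar>lead_coeff Q * l\<bar> = \<bar>c\<bar> * 1" by (metis abs_abs abs_mult mult.left_commute mult.right_neutral)
  then have "\<bar>lead_coeff Q * l\<bar> = 1" using cS(1) by simp
  then have unit: "\<bar>coeff Q 2\<bar> = 1" using Q(2) by (metis abs_zmult_eq_1)
  have "Q = [:coeff Q 0, coeff Q 1, coeff Q 2:]"
    using Q(2) by (auto simp: poly_eq_iff coeff_pCons coeff_eq_0 numeral_2_eq_2 split: nat.splits)
  then obtain q0 q1 q2 where q: "Q = [:q0,q1,q2:]" by blast
  have q2: "q2 = 1 \<or> q2 = -1" using unit by (simp add: q) (auto simp: numeral_2_eq_2)
  have "of_int q0 + of_int q1 * x + of_int q2 * x\<^sup>2 = 0"
    using Qx by (simp add: q map_poly_pCons algebra_simps power2_eq_square)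
  then have "(of_int q0 - of_int q2 * n) + (of_int q1 + of_int q2 * t) * x = 0"
    unfolding tn(3) by (simp add: algebra_simps)
  then have "of_int q0 - of_int q2 * n = 0 \<and> of_int q1 + of_int q2 * t = 0"
    using tn by (intro irrational_linear_eq_0[OF x(1)]) auto
  then have "n = of_int (q2 * q0)" "t = of_int (- q2 * q1)" using q2 by auto
  then show "t \<in> \<int>" "n \<in> \<int>" using Ints_of_int by blast+
qed

text \<open>Dirichlet approximation and pigeonhole: infinitely many fractions \<open>h/k\<close>
  with error below \<open>1/k^2\<close> have norms \<open>h^2 - D * k^2\<close> under a fixed bound,
  so two of them share the norm \<open>N\<close> and the residues modulo \<open>N\<close>. Their
  quotient has norm 1 and integer coordinates.\<close>

lemma pell_solution_exists:
  fixes D :: int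
  assumes "sqrt (of_int D) \<notin> \<rat>" "D > 0"
  shows "\<exists>x y :: int. x > 0 \<and> y > 0 \<and> x\<^sup>2 - D * y\<^sup>2 = 1"
proof -
  define s where "s = sqrt (of_int D)"
  have s: "s\<^sup>2 = D" "s > 0" "s \<notin> \<rat>" using assms by (auto simp: s_def)
  define A where "A = approx_set s"
  have inf: "infinite A" using s rational_iff_finite_approx_set A_def by blast
  define C where "C = \<lceil>2 * s + 1\<rceil>"
  \<comment> \<open>Pairs in one fibre of \<open>\<phi>\<close> have the same norm and the same
    residues modulo it, which is what makes the quotient below integral.\<close>
  define \<phi> where "\<phi> = (\<lambda>(h::int,k). let N = h\<^sup>2 - D * k\<^sup>2 in (N, h mod N, k mod N))"
  have AN: "h\<^sup>2 - D * k\<^sup>2 \<noteq> 0" "\<bar>h\<^sup>2 - D * k\<^sup>2\<bar> \<le> C" "k > 0" "coprime h k" if "(h,k) \<in> A" for h k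
  proof -
    have k: "k > 0" "coprime h k" "\<bar>s - h / k\<bar> < 1 / k\<^sup>2" using that by (auto simp: A_def approx_set_def)
    show "k > 0" "coprime h k" by fact+
    show "h\<^sup>2 - D * k\<^sup>2 \<noteq> 0"
    proof
      assume "h\<^sup>2 - D * k\<^sup>2 = 0"
      then have "(of_int h)\<^sup>2 = s\<^sup>2 * (of_int k)\<^sup>2" unfolding s
        by (metis eq_iff_diff_eq_0 of_int_mult of_int_power)
      then have "s\<^sup>2 = (h / k)\<^sup>2" using k by (simp add: field_simps)
      then have "s = \<bar>h / k\<bar>" using s(2) by (metis abs_of_pos power2_eq_iff_nonneg abs_ge_zero less_imp_le power2_abs)
      then show False using s(3) by auto
    qed
    \<comment> \<open>Up to sign the norm is \<open>(s - h/k) * (s + h/k) * k^2\<close>. The first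
      factor absorbs \<open>k^2\<close>, and the second is at most \<open>2 * s + 1\<close> because
      \<open>h/k\<close> lies within 1 of \<open>s\<close>.\<close>
    have "real_of_int \<bar>h\<^sup>2 - D * k\<^sup>2\<bar> = \<bar>s - h/k\<bar> * (\<bar>s + h/k\<bar> * k\<^sup>2)"
    proof -
      have "real_of_int (h\<^sup>2 - D * k\<^sup>2) = - ((s - h/k) * ((s + h/k) * k\<^sup>2))"
        using k s(1) by (simp add: field_simps power2_eq_square)
      then show ?thesis by (simp add: abs_mult)
    qed
    also have "\<dots> \<le> (1 / k\<^sup>2) * (\<bar>s + h/k\<bar> * k\<^sup>2)" using k by (intro mult_right_mono) auto
    also have "\<dots> = \<bar>s + h/k\<bar>" using k by simp
    also have "\<dots> \<le> 2 * s + 1"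
    proof -
      have "1 / (of_int k)\<^sup>2 \<le> (1::real)" using k by (simp add: divide_simps)
      then show ?thesis using k(3) s(2) by (simp only: of_int_power)
    qed
    finally show "\<bar>h\<^sup>2 - D * k\<^sup>2\<bar> \<le> C" unfolding C_def by linarith
  qed
  have modb: "\<bar>a mod N\<bar> \<le> C" if "N \<noteq> 0" "\<bar>N\<bar> \<le> C" for a N :: int
    using abs_mod_less[OF that(1), of a] that(2) by linarith
  have "\<phi> ` A \<subseteq> {-C..C} \<times> {-C..C} \<times> {-C..C}"
  proof
    fix z assume "z \<in> \<phi> ` A"
    then obtain h k where hk: "(h,k) \<in> A" "z = \<phi> (h,k)" by auto
    show "z \<in> {-C..C} \<times> {-C..C} \<times> {-C..C}"
      using AN[OF hk(1)] modb[of "h\<^sup>2 - D * k\<^sup>2"] unfolding hk(2) \<phi>_def Let_def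
      by (auto simp: abs_le_iff minus_le_iff)
  qed
  then have "finite (\<phi> ` A)" by (rule finite_subset) auto
  then obtain a0 where a0: "a0 \<in> A" "infinite {a\<in>A. \<phi> a = \<phi> a0}" using pigeonhole_infinite[OF inf] by blast
  \<comment> \<open>An infinite fibre has a member other than \<open>a0\<close>, which supplies the
    second pair.\<close>
  then have "infinite ({a\<in>A. \<phi> a = \<phi> a0} - {a0})" by simp
  then obtain b0 where "b0 \<in> {a\<in>A. \<phi> a = \<phi> a0} - {a0}" by (metis finite.emptyI ex_in_conv)
  then obtain h1 k1 h2 k2 where hk: "(h1,k1) \<in> A" "(h2,k2) \<in> A" "(h1,k1) \<noteq> (h2,k2)" "\<phi> (h1,k1) = \<phi> (h2,k2)"
    using a0(1) by (cases a0, cases b0) auto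
  define N where "N = h1\<^sup>2 - D * k1\<^sup>2"
  have N: "N \<noteq> 0" "N = h2\<^sup>2 - D * k2\<^sup>2" "h1 mod N = h2 mod N" "k1 mod N = k2 mod N"
    using hk(4) AN(1)[OF hk(1)] by (auto simp: \<phi>_def N_def Let_def)
  obtain a where a: "h2 = h1 + N * a" using N(3) by (metis mod_eqE add.commute diff_add_cancel mult.commute)
  obtain b where b: "k2 = k1 + N * b" using N(4) by (metis mod_eqE add.commute diff_add_cancel mult.commute)
  \<comment> \<open>\<open>X + Y * s\<close> is the quotient of \<open>h1 + k1 * s\<close> by
    \<open>h2 + k2 * s\<close>, that is, \<open>(h1 + k1 * s) * (h2 - k2 * s) / N\<close>;
    substituting the two congruences carries out the division by \<open>N\<close>.\<close>
  define X where "X = 1 + h1 * a - D * k1 * b"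
  define Y where "Y = k1 * a - h1 * b"
  have X: "N * X = h1 * h2 - D * k1 * k2" unfolding X_def a b by (simp add: N_def algebra_simps power2_eq_square)
  have Y: "N * Y = k1 * h2 - h1 * k2" unfolding Y_def a b by (simp add: algebra_simps)
  have "N\<^sup>2 * (X\<^sup>2 - D * Y\<^sup>2) = (N * X)\<^sup>2 - D * (N * Y)\<^sup>2" by (simp add: algebra_simps)
  also have "\<dots> = (h1\<^sup>2 - D * k1\<^sup>2) * (h2\<^sup>2 - D * k2\<^sup>2)" unfolding X Y by (simp add: algebra_simps power2_eq_square)
  also have "\<dots> = N\<^sup>2" unfolding N(2)[symmetric] N_def[symmetric] by (simp add: power2_eq_square)
  finally have XY: "X\<^sup>2 - D * Y\<^sup>2 = 1" using N(1) by simp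
  \<comment> \<open>\<open>Y = 0\<close> would make the fractions \<open>h1/k1\<close> and
    \<open>h2/k2\<close> equal. Both are in lowest terms with positive denominator, so the two pairs
    would coincide.\<close>
  have "Y \<noteq> 0"
  proof
    assume "Y = 0"
    then have e: "k1 * h2 = h1 * k2" using Y by simp
    have "k1 dvd k2" using e AN(4)[OF hk(1)] by (metis coprime_commute coprime_dvd_mult_right_iff dvd_triv_left)
    moreover have "k2 dvd k1" using e AN(4)[OF hk(2)] by (metis coprime_commute coprime_dvd_mult_left_iff dvd_triv_right)
    ultimately have "k1 = k2" using AN(3)[OF hk(1)] AN(3)[OF hk(2)] by (simp add: zdvd_antisym_nonneg)
    then show False using e hk(3) AN(3)[OF hk(1)] by auto
  qed
  moreover have "X \<noteq> 0"
  proof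
    assume "X = 0"
    then have "D * Y\<^sup>2 = -1" using XY by simp
    moreover have "D * Y\<^sup>2 \<ge> 0" using assms(2) by simp
    ultimately show False by linarith
  qed
  ultimately show ?thesis using XY by (intro exI[of _ "\<bar>X\<bar>"] exI[of _ "\<bar>Y\<bar>"]) auto
qed

section \<open>Structure of real quadratic fields\<close>

lemma sqrt_squarefree_irrational:
  fixes D :: int
  assumes "squarefree D" "D > 1"
  shows "sqrt (of_int D) \<notin> \<rat>"
proof
  assume "sqrt (of_int D) \<in> \<rat>"
  moreover have "algebraic_int (sqrt (of_int D))" by (intro algebraic_int_sqrt int_imp_algebraic_int) auto
  ultimately have "sqrt (of_int D) \<in> \<int>" using rational_algebraic_int_is_int by blast
  then obtain k where "sqrt (of_int D) = of_int k" by (elim Ints_cases)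
  then have "real_of_int D = of_int k ^ 2" using assms(2) by (metis of_int_0_le_iff less_imp_le real_sqrt_pow2 order.strict_trans zero_less_one)
  then have D: "D = k\<^sup>2" by (metis of_int_eq_iff of_int_power)
  then have "k dvd 1" using assms(1) by (simp add: squarefree_def)
  then have "D = 1" using D by (auto simp: abs_eq_iff[of k 1, simplified])
  then show False using assms(2) by simp
qed

text \<open>Any irrational \<open>a\<close> in \<open>K\<close> forms a rational basis together with
  1, since the dimension is 2. Completing the square in its quadratic equation turns a rational
  shift of \<open>a\<close> into a rational multiple of \<open>sqrt D\<close>.\<close>

lemma quadratic_field_generator:
  assumes "real_quadratic_field K"
  obtains D :: int where "squarefree D" "D > 1" "K = {p + q * sqrt (of_int D) | p q. p \<in> \<rat> \<and> q \<in> \<rat>}"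
proof -
  interpret vs: vector_space "\<lambda>(q::rat) (x::real). of_rat q * x"
    by unfold_locales (simp_all add: algebra_simps of_rat_add of_rat_mult)
  have K1: "1 \<in> K" and Km: "\<And>x y. x \<in> K \<Longrightarrow> y \<in> K \<Longrightarrow> x - y \<in> K" 
    and Kt: "\<And>x y. x \<in> K \<Longrightarrow> y \<in> K \<Longrightarrow> x * y \<in> K" and Ki: "\<And>x. x \<in> K \<Longrightarrow> inverse x \<in> K"
    and dim: "vs.dim K = 2"
    using assms by (auto simp: real_quadratic_field_def real_subfield_def rat_dim_def)
  have K0: "0 \<in> K" using Km[OF K1 K1] by simp
  have Kp: "x + y \<in> K" if "x \<in> K" "y \<in> K" for x y using Km[OF that(1) Km[OF K0 that(2)]] by simp
  have KN: "of_nat n \<in> K" for n by (induction n) (auto intro: K0 Kp K1)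
  have KZ: "of_int n \<in> K" for n using KN Km[OF K0 KN] by (cases n rule: int_cases2) auto
  have KQ: "q \<in> K" if q: "q \<in> \<rat>" for q
  proof -
    obtain a b where "q = of_int a / of_int b" using q by (auto elim: Rats_cases')
    then show ?thesis using Kt[OF KZ Ki[OF KZ], of a b] by (simp only: divide_inverse)
  qed
  have sp1: "vs.span {a} = range (\<lambda>q. of_rat q * a)" for a by (rule vs.span_singleton)
  have sp2: "x \<in> vs.span {1, a} \<longleftrightarrow> (\<exists>p q. p \<in> \<rat> \<and> q \<in> \<rat> \<and> x = p + q * a)" for x a
  proof -
    have "x \<in> vs.span {1,a} \<longleftrightarrow> (\<exists>k. x - of_rat k * 1 \<in> vs.span {a})" by (rule vs.span_breakdown_eq)
    also have "\<dots> \<longleftrightarrow> (\<exists>k l. x = of_rat k + of_rat l * a)"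
      unfolding sp1 by (simp add: image_iff diff_eq_eq add.commute)
    also have "\<dots> \<longleftrightarrow> (\<exists>p q. p \<in> \<rat> \<and> q \<in> \<rat> \<and> x = p + q * a)"
      unfolding Rats_def by blast
    finally show ?thesis .
  qed
  obtain B where B: "B \<subseteq> K" "vs.independent B" "K \<subseteq> vs.span B" "card B = 2"
    by (rule vs.basis_exists[of K]) (simp add: dim)
  have finB: "finite B" using B(4) by (metis card.infinite zero_neq_numeral)
  have "\<exists>a\<in>K. a \<notin> \<rat>"
  proof (rule ccontr)
    assume "\<not> ?thesis"
    then have "K \<subseteq> \<rat>" by auto
    also have "\<dots> = vs.span {1}" unfolding sp1 Rats_def by auto
    finally have "vs.dim K \<le> card {1::real}" by (intro vs.dim_le_card) auto
    then show False using dim by simp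
  qed
  then obtain a where a: "a \<in> K" "a \<notin> \<rat>" by blast
  have ind: "vs.independent {1, a}"
  proof -
    have "a \<notin> vs.span {1}" using a(2) unfolding sp1 Rats_def by auto
    then show ?thesis by (subst insert_commute) (auto simp: vs.independent_insert)
  qed
  have Ksub: "K \<subseteq> vs.span {1, a}"
  proof (rule ccontr)
    assume "\<not> ?thesis"
    \<comment> \<open>An element outside the span would be a third independent vector, too many for
      the two-element basis \<open>B\<close>.\<close>
    then obtain y where y: "y \<in> K" "y \<notin> vs.span {1,a}" by blast
    have i3: "vs.independent (insert y {1,a})" using vs.independent_insertI[OF y(2) ind] .
    have "insert y {1,a} \<subseteq> vs.span B" using y a K1 B(3) by auto
    then have "card (insert y {1,a}) \<le> card B" using vs.independent_span_bound[OF finB i3] by simp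
    moreover have "y \<noteq> 1" "y \<noteq> a" using y(2) vs.span_base[of _ "{1,a}"] by auto
    moreover have "a \<noteq> 1" using a by auto
    ultimately show False using B(4) by auto
  qed
  then have Ka: "K = {p + q * a | p q. p \<in> \<rat> \<and> q \<in> \<rat>}"
    using Kp KQ Kt a(1) unfolding sp2 subset_iff by blast
  obtain p q where pq: "p \<in> \<rat>" "q \<in> \<rat>" "a\<^sup>2 = p + q * a"
    using Kt[OF a(1) a(1)] unfolding Ka by (auto simp: power2_eq_square)
  \<comment> \<open>A quarter of the discriminant of \<open>X^2 - q X - p\<close>, the polynomial
    with root \<open>a\<close>.\<close>
  define r where "r = p + q\<^sup>2 / 4"
  have r: "r \<in> \<rat>" using pq unfolding r_def by auto
  have ra: "(a - q/2)\<^sup>2 = r" using pq(3) by (simp add: r_def power2_eq_square field_simps)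
  have rp: "r > 0"
  proof -
    have "q / 2 \<in> \<rat>" using pq(2) by simp
    then have "a \<noteq> q / 2" using a(2) by blast
    then have "a - q/2 \<noteq> 0" by simp
    then show ?thesis using ra by (metis zero_less_power2)
  qed
  obtain m n :: int where mn: "n > 0" "r = of_int m / of_int n" using r by (auto elim: Rats_cases')
  have mp: "m > 0" using mn rp by (simp add: zero_less_divide_iff)
  \<comment> \<open>Since \<open>r = m * n / n^2\<close>, the square root of \<open>r\<close> is
    that of the integer \<open>m * n\<close> up to a rational factor; splitting off its square part
    leaves \<open>D\<close> and the factor \<open>\<bar>g\<bar> / n\<close>.\<close>
  define D where "D = squarefree_part (m * n)"
  define g where "g = square_part (m * n)"
  have Dg: "m * n = D * g\<^sup>2" unfolding D_def g_def by (rule squarefree_decompose)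
  have g0: "g \<noteq> 0" using mn mp by (auto simp: g_def)
  have sD: "squarefree D" by (simp add: D_def)
  have Dp: "D > 0" using Dg mn mp by (metis mult_pos_pos zero_less_mult_pos2 zero_less_power2 g0)
  define c where "c = real_of_int \<bar>g\<bar> / of_int n"
  have c: "c \<in> \<rat>" "c > 0" using g0 mn by (auto simp: c_def)
  have "r = (c * sqrt (of_int D))\<^sup>2"
  proof -
    have "real_of_int m * of_int n = of_int D * (of_int g)\<^sup>2" using Dg by (metis of_int_mult of_int_power)
    moreover have "r = of_int m * of_int n / (of_int n)\<^sup>2" using mn by (simp add: power2_eq_square)
    ultimately show ?thesis using Dp by (simp add: c_def power_mult_distrib power_divide)
  qed
  then have "(a - q/2)\<^sup>2 = (c * sqrt (of_int D))\<^sup>2" using ra by simp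
  then obtain e where e: "e = 1 \<or> e = -1" "a - q/2 = e * (c * sqrt (of_int D))" by (auto simp: power2_eq_iff) (metis mult_1 mult_minus1)+
  define b where "b = e * c"
  have b: "b \<in> \<rat>" "b \<noteq> 0" "a = q/2 + b * sqrt (of_int D)" using e c by (auto simp: b_def)
  have "D \<noteq> 1" using a(2) b pq by auto
  with Dp have D1: "D > 1" by simp
  have "K = {p + q * sqrt (of_int D) | p q. p \<in> \<rat> \<and> q \<in> \<rat>}" (is "_ = ?R")
  proof (intro equalityI subsetI)
    fix x assume "x \<in> K"
    then obtain y z where yz: "y \<in> \<rat>" "z \<in> \<rat>" "x = y + z * a" unfolding Ka by blast
    have "x = (y + z * (q/2)) + (z * b) * sqrt (of_int D)" unfolding yz b(3) by (simp add: algebra_simps)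
    moreover have "y + z * (q/2) \<in> \<rat>" "z * b \<in> \<rat>" using yz pq b by auto
    ultimately show "x \<in> ?R" by blast
  next
    fix x assume "x \<in> ?R"
    then obtain y z where yz: "y \<in> \<rat>" "z \<in> \<rat>" "x = y + z * sqrt (of_int D)" by blast
    have "sqrt (of_int D) = (a - q/2) / b" using b by simp
    then have "x = y + z * ((a - q/2) / b)" unfolding yz by simp
    then have "x = (y - z * (q/2) / b) + (z / b) * a" by (simp add: diff_divide_distrib algebra_simps)
    moreover have "y - z * (q/2) / b \<in> \<rat>" "z / b \<in> \<rat>" using yz pq b by auto
    ultimately show "x \<in> K" unfolding Ka by blast
  qed
  with sD D1 that show ?thesis by blast
qed

section \<open>The algebraic integers of a real quadratic field\<close>

lemma square_mult_squarefree_Ints: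
  fixes b :: real and D :: int
  assumes "squarefree D" "b \<in> \<rat>" "b\<^sup>2 * of_int D \<in> \<int>"
  shows "b \<in> \<int>"
proof -
  \<comment> \<open>In lowest terms the squared denominator is coprime to the squared numerator, so
    it must divide \<open>D\<close>; squarefreeness then makes the denominator 1.\<close>
  obtain r s :: int where rs: "s > 0" "coprime r s" "b = of_int r / of_int s" using assms(2) by (rule Rats_cases')
  obtain k where "b\<^sup>2 * of_int D = of_int k" using assms(3) by (elim Ints_cases)
  then have "real_of_int (r\<^sup>2 * D) = of_int (k * s\<^sup>2)" using rs by (simp add: field_simps)
  then have "r\<^sup>2 * D = k * s\<^sup>2" by (simp only: of_int_eq_iff)
  then have "s\<^sup>2 dvd r\<^sup>2 * D" by simp
  moreover have "coprime (s\<^sup>2) (r\<^sup>2)" using rs(2) by (simp add: coprime_commute)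
  ultimately have "s\<^sup>2 dvd D" by (simp add: coprime_dvd_mult_right_iff)
  then have "s dvd 1" using assms(1) unfolding squarefree_def by blast
  then have "s = 1" using rs(1) by simp
  then show ?thesis using rs by simp
qed

lemma algebraic_int_quadratic:
  fixes x :: real and t n :: int
  assumes "x\<^sup>2 = of_int t * x - of_int n"
  shows "algebraic_int x"
  unfolding algebraic_int_altdef_ipoly
  by (rule exI[of _ "[:n, -t, 1:]"]) (use assms in \<open>simp add: map_poly_pCons algebra_simps power2_eq_square\<close>)

lemma square_mod_4: "(a::int)\<^sup>2 mod 4 = (if even a then 0 else 1)"
proof (cases "even a")
  case True
  then obtain k where "a = 2 * k" by blast
  then show ?thesis by (simp add: power2_eq_square)
next
  case False
  then obtain k where "a = 2 * k + 1" using oddE by blast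
  then have "a\<^sup>2 = 1 + (k\<^sup>2 + k) * 4" by (simp add: power2_eq_square algebra_simps)
  then show ?thesis using False by (simp only: mod_mult_self1) simp
qed

text \<open>\<open>2 * p\<close> and \<open>p^2 - q^2 * D\<close> are trace and norm of the element.
  Once both are integers, so is \<open>(2 * q)^2 * D\<close>, and then \<open>2 * q\<close> is one
  because \<open>D\<close> is squarefree.\<close>

lemma squarefree_quadratic_integer_iff:
  fixes D :: int and p q :: real
  assumes D: "squarefree D" "D > 1" and pq: "p \<in> \<rat>" "q \<in> \<rat>"
  shows "algebraic_int (p + q * sqrt (of_int D)) \<longleftrightarrow>
    (\<exists>a b :: int. p = of_int a / 2 \<and> q = of_int b / 2 \<and> 4 dvd a\<^sup>2 - b\<^sup>2 * D)"
proof -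
  define s where "s = sqrt (of_int D)"
  have s: "s\<^sup>2 = of_int D" "s \<notin> \<rat>" using D sqrt_squarefree_irrational by (auto simp: s_def)
  define x where "x = p + q * s"
  have x2: "x\<^sup>2 = (2 * p) * x - (p\<^sup>2 - q\<^sup>2 * of_int D)"
    unfolding x_def s(1)[symmetric] by (simp add: power2_eq_square algebra_simps)
  show ?thesis unfolding s_def[symmetric] x_def[symmetric]
  proof
    assume alg: "algebraic_int x"
    have tn: "2 * p \<in> \<int>" "p\<^sup>2 - q\<^sup>2 * of_int D \<in> \<int>"
    proof -
      have "2 * p \<in> \<int> \<and> p\<^sup>2 - q\<^sup>2 * of_int D \<in> \<int>"
      \<comment> \<open>The lemma on quadratic coefficients covers irrational \<open>x\<close> only.
        A rational \<open>x\<close> has \<open>q = 0\<close> and is itself an integer.\<close>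
      proof (cases "x \<in> \<rat>")
        case True
        then have "x \<in> \<int>" using alg rational_algebraic_int_is_int by blast
        moreover have "q = 0" using irrational_linear_inject[OF s(2) pq True, of 0] x_def by simp
        ultimately show ?thesis by (simp add: x_def)
      next
        case False
        then show ?thesis using quadratic_algebraic_int_coeffs[OF False alg _ _ x2] pq by auto
      qed
      then show "2 * p \<in> \<int>" "p\<^sup>2 - q\<^sup>2 * of_int D \<in> \<int>" by auto
    qed
    obtain a where a: "2 * p = of_int a" using tn(1) by (elim Ints_cases)
    obtain n where n: "p\<^sup>2 - q\<^sup>2 * of_int D = of_int n" using tn(2) by (elim Ints_cases)
    have e: "(2*q)\<^sup>2 * of_int D = (of_int a)\<^sup>2 - 4 * of_int n"
      unfolding a[symmetric] n[symmetric] by (simp add: algebra_simps)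
    have "2 * q \<in> \<int>"
    proof (rule square_mult_squarefree_Ints[OF D(1)])
      show "(2*q)\<^sup>2 * of_int D \<in> \<int>" unfolding e by simp
    qed (use pq in auto)
    then obtain b where b: "2 * q = of_int b" by (elim Ints_cases)
    have "real_of_int (b\<^sup>2 * D) = of_int (a\<^sup>2 - 4 * n)" using e unfolding b by simp
    then have "b\<^sup>2 * D = a\<^sup>2 - 4 * n" by (simp only: of_int_eq_iff)
    then have "4 dvd a\<^sup>2 - b\<^sup>2 * D" by simp
    moreover have "p = of_int a / 2" "q = of_int b / 2" using a b by simp_all
    ultimately show "\<exists>a b :: int. p = of_int a / 2 \<and> q = of_int b / 2 \<and> 4 dvd a\<^sup>2 - b\<^sup>2 * D" by blast
  next
    assume "\<exists>a b :: int. p = of_int a / 2 \<and> q = of_int b / 2 \<and> 4 dvd a\<^sup>2 - b\<^sup>2 * D"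
    then obtain a b n :: int where ab: "p = of_int a / 2" "q = of_int b / 2" "a\<^sup>2 - b\<^sup>2 * D = 4 * n" by (auto elim: dvdE)
    have "4 * (p\<^sup>2 - q\<^sup>2 * of_int D) = of_int (a\<^sup>2 - b\<^sup>2 * D)" by (simp add: ab(1,2) power_divide algebra_simps)
    then have "p\<^sup>2 - q\<^sup>2 * of_int D = of_int n" unfolding ab(3) by simp
    then show "algebraic_int x" using x2 ab(1) by (intro algebraic_int_quadratic[of x a n]) simp
  qed
qed

text \<open>Coordinates with respect to 1 and \<open>(\<Delta> + sqrt \<Delta>) / 2\<close>. This
  choice of basis serves the residues 0 and 1 of \<open>\<Delta>\<close> modulo 4 alike.\<close>

definition quad_int :: "int \<Rightarrow> int \<Rightarrow> int \<Rightarrow> real" where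
  "quad_int \<Delta> m n = of_int m + of_int n * ((of_int \<Delta> + sqrt (of_int \<Delta>)) / 2)"

text \<open>\<open>\<Delta>\<close> is \<open>D\<close> if \<open>D mod 4 = 1\<close> and
  \<open>4 * D\<close> otherwise. In each case divisibility by 4 in the integrality criterion
  becomes a condition on parities. The third property says that the basis element
  \<open>(\<Delta> + sqrt \<Delta>) / 2\<close> has integer norm.\<close>

lemma real_quadratic_field_structure:
  assumes "real_quadratic_field K"
  obtains \<Delta> :: int where "\<Delta> > 0" "sqrt (of_int \<Delta>) \<notin> \<rat>" "4 dvd \<Delta>\<^sup>2 - \<Delta>"
    "K = {p + q * sqrt (of_int \<Delta>) | p q. p \<in> \<rat> \<and> q \<in> \<rat>}"
    "ring_of_integers K = {quad_int \<Delta> m n | m n. True}"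
proof -
  obtain D :: int where D: "squarefree D" "D > 1" and K: "K = {p + q * sqrt (of_int D) | p q. p \<in> \<rat> \<and> q \<in> \<rat>}"
    using quadratic_field_generator[OF assms] .
  define s where "s = sqrt (of_int D)"
  have s: "s \<notin> \<rat>" using sqrt_squarefree_irrational[OF D] s_def by simp
  have OK: "x \<in> ring_of_integers K \<longleftrightarrow> (\<exists>a b :: int. x = of_int a / 2 + of_int b / 2 * s \<and> 4 dvd a\<^sup>2 - b\<^sup>2 * D)" for x
  proof
    assume "x \<in> ring_of_integers K"
    then show "\<exists>a b :: int. x = of_int a / 2 + of_int b / 2 * s \<and> 4 dvd a\<^sup>2 - b\<^sup>2 * D"
      using squarefree_quadratic_integer_iff[OF D] unfolding ring_of_integers_def K s_def by blast
  next
    assume "\<exists>a b :: int. x = of_int a / 2 + of_int b / 2 * s \<and> 4 dvd a\<^sup>2 - b\<^sup>2 * D"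
    then obtain a b :: int where ab: "x = of_int a / 2 + of_int b / 2 * s" "4 dvd a\<^sup>2 - b\<^sup>2 * D" by blast
    have "of_int a / 2 \<in> (\<rat> :: real set)" "of_int b / 2 \<in> (\<rat> :: real set)" by auto
    then show "x \<in> ring_of_integers K"
      using squarefree_quadratic_integer_iff[OF D] ab unfolding ring_of_integers_def K s_def by blast
  qed
  have D4: "\<not> 4 dvd D"
  proof
    assume "4 dvd D"
    then have "2\<^sup>2 dvd D" by simp
    then have "(2::int) dvd 1" using D(1) unfolding squarefree_def by blast
    then show False by simp
  qed
  show ?thesis
  proof (cases "D mod 4 = 1")
    case True
    obtain k where k: "D = 4 * k + 1" using True by (metis mult_div_mod_eq)
    show ?thesis
    proof (rule that[of D])
      show "D > 0" using D by simp
      show "sqrt (of_int D) \<notin> \<rat>" using s s_def by simp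
      show "4 dvd D\<^sup>2 - D" unfolding k by (simp add: power2_eq_square algebra_simps)
      show "ring_of_integers K = {quad_int D m n | m n. True}"
      proof (rule set_eqI)
        fix x
        \<comment> \<open>\<open>D\<close> is 1 modulo 4 and drops out; a square modulo 4 depends
          only on the parity of its root.\<close>
        have par: "4 dvd a\<^sup>2 - b\<^sup>2 * D \<longleftrightarrow> (even a \<longleftrightarrow> even b)" for a b :: int
        proof -
          have "a\<^sup>2 - b\<^sup>2 * D = (a\<^sup>2 - b\<^sup>2) - 4 * (b\<^sup>2 * k)" by (simp add: k algebra_simps)
          then have "4 dvd a\<^sup>2 - b\<^sup>2 * D \<longleftrightarrow> 4 dvd a\<^sup>2 - b\<^sup>2" by (simp only: dvd_diff_left_iff[OF dvd_triv_left])
          also have "\<dots> \<longleftrightarrow> a\<^sup>2 mod 4 = b\<^sup>2 mod 4" by (simp add: mod_eq_dvd_iff)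
          also have "\<dots> \<longleftrightarrow> (even a \<longleftrightarrow> even b)" by (simp add: square_mod_4)
          finally show ?thesis .
        qed
        show "x \<in> ring_of_integers K \<longleftrightarrow> x \<in> {quad_int D m n | m n. True}"
        proof
          assume "x \<in> ring_of_integers K"
          then obtain a b :: int where ab: "x = of_int a / 2 + of_int b / 2 * s" "even a \<longleftrightarrow> even b" unfolding OK par by blast
          have "even (a - b * D)" using ab(2) by (simp add: k)
          then obtain m where "a = b * D + 2 * m" by (metis diff_add_cancel add.commute dvdE)
          then have "x = quad_int D m b" unfolding ab(1) quad_int_def s_def by (simp add: field_simps)
          then show "x \<in> {quad_int D m n | m n. True}" by blast
        next
          assume "x \<in> {quad_int D m n | m n. True}"
          then obtain m n where "x = quad_int D m n" by blast
          then have "x = of_int (2 * m + n * D) / 2 + of_int n / 2 * s" by (simp add: quad_int_def s_def field_simps)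
          moreover have "even (2 * m + n * D) \<longleftrightarrow> even n" by (simp add: k)
          ultimately show "x \<in> ring_of_integers K" unfolding OK par by blast
        qed
      qed
    qed (rule K)
  next
    case False
    have sq: "sqrt (of_int (4 * D)) = 2 * s" by (simp add: s_def real_sqrt_mult)
    \<comment> \<open>Now \<open>D\<close> is 2 or 3 modulo 4, hence no square there, so
      \<open>b\<close> cannot be odd; then \<open>a\<close> is even as well.\<close>
    have par: "4 dvd a\<^sup>2 - b\<^sup>2 * D \<longleftrightarrow> even a \<and> even b" for a b :: int
    proof -
      have "4 dvd a\<^sup>2 - b\<^sup>2 * D \<longleftrightarrow> a\<^sup>2 mod 4 = (b\<^sup>2 * D) mod 4" by (simp add: mod_eq_dvd_iff)
      also have "\<dots> \<longleftrightarrow> a\<^sup>2 mod 4 = ((b\<^sup>2 mod 4) * D) mod 4" by (simp add: mod_mult_left_eq)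
      also have "\<dots> \<longleftrightarrow> even a \<and> even b" 
        using False D4 by (cases "even a"; cases "even b") (simp_all add: square_mod_4 dvd_eq_mod_eq_0 del: dvd_imp_mod_0)
      finally show ?thesis .
    qed
    show ?thesis
    proof (rule that[of "4 * D"])
      show "4 * D > 0" using D by simp
      show "sqrt (of_int (4 * D)) \<notin> \<rat>" unfolding sq
      proof
        assume "2 * s \<in> \<rat>"
        then have "2 * s / 2 \<in> \<rat>" by (intro Rats_divide) auto
        then show False using s by simp
      qed
      show "4 dvd (4 * D)\<^sup>2 - 4 * D" by (simp add: power2_eq_square)
      show "K = {p + q * sqrt (of_int (4 * D)) | p q. p \<in> \<rat> \<and> q \<in> \<rat>}" unfolding K sq s_def[symmetric]
      proof (intro equalityI subsetI)
        fix x assume "x \<in> {p + q * s | p q. p \<in> \<rat> \<and> q \<in> \<rat>}"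
        then obtain p q where pq: "p \<in> \<rat>" "q \<in> \<rat>" "x = p + q * s" by blast
        then have "x = p + (q / 2) * (2 * s)" "q / 2 \<in> \<rat>" by auto
        then show "x \<in> {p + q * (2 * s) | p q. p \<in> \<rat> \<and> q \<in> \<rat>}" using pq(1) by blast
      next
        fix x assume "x \<in> {p + q * (2 * s) | p q. p \<in> \<rat> \<and> q \<in> \<rat>}"
        then obtain p q where pq: "p \<in> \<rat>" "q \<in> \<rat>" "x = p + q * (2 * s)" by blast
        then have "x = p + (q * 2) * s" "q * 2 \<in> \<rat>" by auto
        then show "x \<in> {p + q * s | p q. p \<in> \<rat> \<and> q \<in> \<rat>}" using pq(1) by blast
      qed
      show "ring_of_integers K = {quad_int (4 * D) m n | m n. True}"
      proof (rule set_eqI)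
        fix x
        show "x \<in> ring_of_integers K \<longleftrightarrow> x \<in> {quad_int (4 * D) m n | m n. True}"
        proof
          assume "x \<in> ring_of_integers K"
          then obtain a b :: int where ab: "x = of_int a / 2 + of_int b / 2 * s" "even a" "even b" unfolding OK par by blast
          then obtain c d where cd: "a = 2 * c" "b = 2 * d" by blast
          \<comment> \<open>The second basis element is \<open>2 * D + s\<close>; the correction
            \<open>2 * D * d\<close> removes its rational part.\<close>
          have "x = quad_int (4 * D) (c - 2 * D * d) d" unfolding ab(1) quad_int_def sq cd by (simp add: field_simps)
          then show "x \<in> {quad_int (4 * D) m n | m n. True}" by blast
        next
          assume "x \<in> {quad_int (4 * D) m n | m n. True}"
          then obtain m n where "x = quad_int (4 * D) m n" by blast
          then have "x = of_int (2 * (m + 2 * D * n)) / 2 + of_int (2 * n) / 2 * s" unfolding quad_int_def sq by (simp add: field_simps)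
          moreover have "even (2 * (m + 2 * D * n)) \<and> even (2 * n)" by simp
          ultimately show "x \<in> ring_of_integers K" unfolding OK par by blast
        qed
      qed
    qed
  qed
qed

section \<open>Integer powers of -1 and attained minima of sets of reals\<close>

lemma minus_one_powi: "(-1 :: real) powi n = (if even n then 1 else -1)"
  by (auto simp: power_int_def minus_one_power_iff even_nat_iff)

text \<open>The reals are not well-ordered, so \<open>LEAST\<close> is meaningful only if a minimum
  is attained; finitely many candidates up to a witness guarantee one.\<close>

lemma Least_discrete:
  fixes P :: "real \<Rightarrow> bool"
  assumes "P x0" "finite {x. P x \<and> x \<le> x0}"
  shows "P (Least P)" "\<And>x. P x \<Longrightarrow> Least P \<le> x"
proof -
  define m where "m = Min {x. P x \<and> x \<le> x0}"
  have "m \<in> {x. P x \<and> x \<le> x0}" unfolding m_def using assms by (intro Min_in) auto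
  moreover have least: "m \<le> x" if "P x" for x
  proof (cases "x \<le> x0")
    case True
    then show ?thesis unfolding m_def using assms that by (intro Min_le) auto
  next
    case False
    moreover have "m \<le> x0" unfolding m_def using assms by (intro Min_le) auto
    ultimately show ?thesis by simp
  qed
  ultimately have "Least P = m" by (intro Least_equality) auto
  then show "P (Least P)" "\<And>x. P x \<Longrightarrow> Least P \<le> x" using least \<open>m \<in> _\<close> by auto
qed

section \<open>Conjugation, automorphisms and the discriminant\<close>

locale quadratic_field =
  fixes K :: "real set" and \<Delta> :: int
  assumes disc_pos: "\<Delta> > 0"
    and irrational: "sqrt (of_int \<Delta>) \<notin> \<rat>"
    and disc_cong: "4 dvd \<Delta>\<^sup>2 - \<Delta>"
    and K_eq: "K = {p + q * sqrt (of_int \<Delta>) | p q. p \<in> \<rat> \<and> q \<in> \<rat>}"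
    and integers_eq: "ring_of_integers K = {quad_int \<Delta> m n | m n. True}"
begin

abbreviation rt :: real where "rt \<equiv> sqrt (of_int \<Delta>)"

lemma rt_square: "rt * rt = of_int \<Delta>" using disc_pos by simp

lemma rt_ge_1: "rt \<ge> 1" using disc_pos by simp

lemma K_cases:
  assumes "x \<in> K"
  obtains p q where "p \<in> \<rat>" "q \<in> \<rat>" "x = p + q * rt"
  using assms unfolding K_eq by blast

lemma K_I: "p \<in> \<rat> \<Longrightarrow> q \<in> \<rat> \<Longrightarrow> p + q * rt \<in> K"
  unfolding K_eq by blast

text \<open>Conjugation. On \<open>K\<close> the description determines \<open>y\<close>, because
  rational coordinates with respect to 1 and the irrational \<open>rt\<close> are unique.\<close>

definition cj :: "real \<Rightarrow> real" where
  "cj x = (THE y. \<exists>p q. p \<in> \<rat> \<and> q \<in> \<rat> \<and> x = p + q * rt \<and> y = p - q * rt)"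

lemma cj_eq:
  assumes "p \<in> \<rat>" "q \<in> \<rat>"
  shows "cj (p + q * rt) = p - q * rt"
  unfolding cj_def
proof (rule the_equality)
  fix y assume "\<exists>p' q'. p' \<in> \<rat> \<and> q' \<in> \<rat> \<and> p + q * rt = p' + q' * rt \<and> y = p' - q' * rt"
  then obtain p' q' where "p' \<in> \<rat>" "q' \<in> \<rat>" "p + q * rt = p' + q' * rt" "y = p' - q' * rt" by blast
  then show "y = p - q * rt" using irrational_linear_inject[OF irrational assms] by blast
qed (use assms in blast)

lemma Rats_subset_K: "p \<in> \<rat> \<Longrightarrow> p \<in> K"
  using K_I[of p 0] by simp

lemma rt_in_K: "rt \<in> K"
  using K_I[of 0 1] by simp

lemma cj_rat: "p \<in> \<rat> \<Longrightarrow> cj p = p"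
  using cj_eq[of p 0] by simp

lemma cj_rt: "cj rt = - rt"
  using cj_eq[of 0 1] by simp

lemma
  assumes "x \<in> K" "y \<in> K"
  shows K_add: "x + y \<in> K" and cj_add: "cj (x + y) = cj x + cj y"
    and K_mult: "x * y \<in> K" and cj_mult: "cj (x * y) = cj x * cj y"
proof -
  obtain a b where x: "a \<in> \<rat>" "b \<in> \<rat>" "x = a + b * rt" using assms(1) by (rule K_cases)
  obtain c d where y: "c \<in> \<rat>" "d \<in> \<rat>" "y = c + d * rt" using assms(2) by (rule K_cases)
  have s: "x + y = (a + c) + (b + d) * rt" unfolding x y by (simp add: algebra_simps)
  have "(a + b * rt) * (c + d * rt) = a * c + b * d * (rt * rt) + (a * d + b * c) * rt"
    by (simp only: algebra_simps)
  then have m: "x * y = (a * c + b * d * of_int \<Delta>) + (a * d + b * c) * rt" unfolding x y rt_square .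
  show "x + y \<in> K" "x * y \<in> K" unfolding s m using x y by (auto intro!: K_I)
  have "cj (x + y) = (a + c) - (b + d) * rt" unfolding s using x y by (intro cj_eq) auto
  then show "cj (x + y) = cj x + cj y" unfolding x y cj_eq[OF x(1,2)] cj_eq[OF y(1,2)] by (simp add: algebra_simps)
  have "(a - b * rt) * (c - d * rt) = a * c + b * d * (rt * rt) - (a * d + b * c) * rt"
    by (simp only: algebra_simps)
  moreover have "cj (x * y) = (a * c + b * d * of_int \<Delta>) - (a * d + b * c) * rt" unfolding m using x y by (intro cj_eq) auto
  ultimately show "cj (x * y) = cj x * cj y" unfolding x(3) y(3) cj_eq[OF x(1,2)] cj_eq[OF y(1,2)] rt_square by simp
qed

lemma
  assumes "x \<in> K"
  shows K_cj: "cj x \<in> K" and cj_cj: "cj (cj x) = x"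
proof -
  obtain a b where x: "a \<in> \<rat>" "b \<in> \<rat>" "x = a + b * rt" using assms by (rule K_cases)
  have c: "cj x = a + (- b) * rt" unfolding x(3) cj_eq[OF x(1,2)] by simp
  show "cj x \<in> K" unfolding c using x by (intro K_I) auto
  have "cj (cj x) = a - (- b) * rt" unfolding c using x by (intro cj_eq) auto
  then show "cj (cj x) = x" using x(3) by simp
qed

lemma cj_minus: "x \<in> K \<Longrightarrow> cj (- x) = - cj x"
  using cj_mult[of "-1" x] Rats_subset_K[of "-1"] cj_rat[of "-1"] by simp

lemma K_power: "x \<in> K \<Longrightarrow> x ^ n \<in> K"
  by (induction n) (auto intro: K_mult Rats_subset_K)

lemma cj_power: "x \<in> K \<Longrightarrow> cj (x ^ n) = cj x ^ n"
  by (induction n) (auto simp: cj_mult K_power cj_rat)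

text \<open>An automorphism fixes the rationals and sends \<open>rt\<close> to a square root of
  \<open>\<Delta>\<close>, so the sign of that image determines it on \<open>K\<close>;
  \<open>extensional K\<close> turns this into an equality of functions.\<close>

lemma field_aut_cases:
  assumes "\<sigma> \<in> field_auts K"
  shows "\<sigma> = restrict (\<lambda>x. x) K \<or> \<sigma> = restrict cj K"
proof -
  have ext: "\<sigma> \<in> extensional K" and bij: "bij_betw \<sigma> K K"
    and add: "\<And>x y. x \<in> K \<Longrightarrow> y \<in> K \<Longrightarrow> \<sigma> (x + y) = \<sigma> x + \<sigma> y"
    and mult: "\<And>x y. x \<in> K \<Longrightarrow> y \<in> K \<Longrightarrow> \<sigma> (x * y) = \<sigma> x * \<sigma> y"
    using assms by (auto simp: field_auts_def)
  have Z: "of_int n \<in> K" for n by (intro Rats_subset_K) simp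
  have s0: "\<sigma> 0 = 0" using add[of 0 0] Z[of 0] by simp
  \<comment> \<open>\<open>\<sigma> 1\<close> is idempotent, hence 0 or 1; injectivity excludes
    0.\<close>
  have "\<sigma> 1 \<noteq> \<sigma> 0" using bij Z[of 0] Z[of 1] inj_on_contraD[of \<sigma> K 1 0] by (simp add: bij_betw_def)
  then have s1: "\<sigma> 1 = 1" using mult[of 1 1] Z[of 1] s0 by simp
  have sN: "\<sigma> (of_nat n) = of_nat n" for n
  proof (induction n)
    case (Suc n)
    then show ?case using add[of 1 "of_nat n"] Z[of 1] Z[of "int n"] s1 by simp
  qed (use s0 in simp)
  have sZ: "\<sigma> (of_int n) = of_int n" for n
  proof (cases n rule: int_cases2)
    case (nonneg k)
    then show ?thesis using sN by simp
  next
    case (nonpos k)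
    then show ?thesis using sN[of k] s0 add[of "of_nat k" "- of_nat k"] Z[of "int k"] Z[of "- int k"] by simp
  qed
  have sQ: "\<sigma> q = q" if q: "q \<in> \<rat>" for q
  proof -
    obtain a b :: int where ab: "b > 0" "q = of_int a / of_int b" using q by (auto elim: Rats_cases')
    have "\<sigma> (q * of_int b) = \<sigma> q * of_int b" using mult[of q "of_int b"] Z Rats_subset_K[OF q] sZ by simp
    moreover have "q * of_int b = of_int a" using ab by simp
    ultimately have "\<sigma> q * of_int b = q * of_int b" using sZ[of a] by metis
    then show ?thesis using ab(1) by simp
  qed
  have "\<sigma> rt * \<sigma> rt = rt * rt" using mult[OF rt_in_K rt_in_K] sZ[of \<Delta>] unfolding rt_square by simp
  then have "\<sigma> rt = rt \<or> \<sigma> rt = - rt" by (simp only: square_eq_iff)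
  moreover have val: "\<sigma> (p + q * rt) = p + q * \<sigma> rt" if "p \<in> \<rat>" "q \<in> \<rat>" for p q
    using add[of p "q * rt"] mult[of q rt] that sQ by (simp add: Rats_subset_K K_mult rt_in_K)
  ultimately show ?thesis
  proof (elim disjE)
    assume "\<sigma> rt = rt"
    then have "\<sigma> x = x" if "x \<in> K" for x using val that by (auto elim!: K_cases)
    then have "\<sigma> = restrict (\<lambda>x. x) K" using ext by (intro extensionalityI[of _ K]) auto
    then show ?thesis ..
  next
    assume "\<sigma> rt = - rt"
    then have "\<sigma> x = cj x" if "x \<in> K" for x using val that cj_eq by (auto elim!: K_cases)
    then have "\<sigma> = restrict cj K" using ext by (intro extensionalityI[of _ K]) auto
    then show ?thesis ..
  qed
qed

lemma field_auts_eq: "field_auts K = {restrict (\<lambda>x. x) K, restrict cj K}"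
proof -
  have "bij_betw (restrict (\<lambda>x. x) K) K K" by (simp add: bij_betw_def inj_on_def)
  then have "restrict (\<lambda>x. x) K \<in> field_auts K" by (auto simp: field_auts_def K_add K_mult)
  moreover have "bij_betw (restrict cj K) K K"
    by (rule bij_betw_byWitness[of _ cj]) (auto simp: cj_cj K_cj)
  then have "restrict cj K \<in> field_auts K" by (auto simp: field_auts_def K_add K_mult cj_add cj_mult)
  ultimately show ?thesis using field_aut_cases by blast
qed

text \<open>Keeps the product and the sum over \<open>field_auts K\<close> from collapsing to a
  single term; \<open>rt\<close> separates the two maps.\<close>

lemma field_auts_distinct: "restrict (\<lambda>x. x) K \<noteq> restrict cj K"
proof
  assume "restrict (\<lambda>x. x) K = restrict cj K"
  then have "restrict (\<lambda>x. x) K rt = restrict cj K rt" by simp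
  then show False using rt_in_K cj_rt rt_ge_1 by simp
qed

lemma field_norm_eq: "x \<in> K \<Longrightarrow> field_norm K x = x * cj x"
  using field_auts_distinct by (simp add: field_norm_def field_auts_eq)

lemma field_trace_eq: "x \<in> K \<Longrightarrow> field_trace K x = x + cj x"
  using field_auts_distinct by (simp add: field_trace_def field_auts_eq)

lemma quad_int_eq: "quad_int \<Delta> m n = (of_int m + of_int n * of_int \<Delta> / 2) + (of_int n / 2) * rt"
  by (simp add: quad_int_def field_simps)

lemma quad_int_in_K: "quad_int \<Delta> m n \<in> K"
  unfolding quad_int_eq by (intro K_I) auto

lemma cj_quad_int: "cj (quad_int \<Delta> m n) = quad_int \<Delta> (m + n * \<Delta>) (- n)"
proof -
  have "cj (quad_int \<Delta> m n) = (of_int m + of_int n * of_int \<Delta> / 2) - (of_int n / 2) * rt"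
    unfolding quad_int_eq by (intro cj_eq) auto
  also have "\<dots> = quad_int \<Delta> (m + n * \<Delta>) (- n)" by (simp add: quad_int_eq)
  finally show ?thesis .
qed

text \<open>The basis element \<open>w = (\<Delta> + rt) / 2\<close> satisfies
  \<open>w * w = \<Delta> * w - N\<close> with norm \<open>N = (\<Delta>^2 - \<Delta>) / 4\<close>,
  an integer by \<open>disc_cong\<close>.\<close>

lemma quad_int_mult:
  "quad_int \<Delta> a b * quad_int \<Delta> c d =
    quad_int \<Delta> (a * c - b * d * ((\<Delta>\<^sup>2 - \<Delta>) div 4)) (a * d + b * c + b * d * \<Delta>)"
proof -
  define N where "N = (\<Delta>\<^sup>2 - \<Delta>) div 4"
  define w where "w = (of_int \<Delta> + rt) / 2"
  have "4 * N = \<Delta>\<^sup>2 - \<Delta>" using disc_cong by (simp add: N_def)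
  then have N: "4 * real_of_int N = (of_int \<Delta>)\<^sup>2 - of_int \<Delta>"
    by (metis of_int_diff of_int_mult of_int_numeral of_int_power)
  have "4 * (w * w) = of_int \<Delta> * of_int \<Delta> + 2 * of_int \<Delta> * rt + rt * rt"
    by (simp add: w_def field_simps del: real_sqrt_mult_self)
  also have "\<dots> = 4 * (of_int \<Delta> * w - of_int N)"
    unfolding rt_square right_diff_distrib[of 4] N by (simp add: w_def power2_eq_square algebra_simps)
  finally have w: "w * w = of_int \<Delta> * w - of_int N" by simp
  have "(of_int a + of_int b * w) * (of_int c + of_int d * w) =
      of_int a * of_int c + (of_int a * of_int d + of_int b * of_int c) * w + of_int b * of_int d * (w * w)"
    by (simp add: algebra_simps)
  also have "\<dots> = of_int (a * c - b * d * N) + of_int (a * d + b * c + b * d * \<Delta>) * w"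
    unfolding w by (simp add: algebra_simps)
  finally show ?thesis unfolding quad_int_def w_def N_def .
qed

lemma quad_int_inject: "quad_int \<Delta> a b = quad_int \<Delta> c d \<longleftrightarrow> a = c \<and> b = d"
proof
  assume "quad_int \<Delta> a b = quad_int \<Delta> c d"
  then have "of_int a + of_int b * of_int \<Delta> / 2 = (of_int c + of_int d * of_int \<Delta> / 2 :: real) \<and> of_int b / 2 = (of_int d / 2 :: real)"
    unfolding quad_int_eq by (intro irrational_linear_inject[OF irrational]) auto
  then show "a = c \<and> b = d" by auto
qed simp

lemma quad_int_minus_cj: "quad_int \<Delta> a b - cj (quad_int \<Delta> a b) = of_int b * rt"
  unfolding cj_quad_int unfolding quad_int_eq by (simp add: field_simps)

lemma quad_int_plus_cj: "quad_int \<Delta> a b + cj (quad_int \<Delta> a b) = of_int (2 * a + b * \<Delta>)"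
  unfolding cj_quad_int unfolding quad_int_eq by (simp add: field_simps)

lemma quad_int_mult_cj: "quad_int \<Delta> a b * cj (quad_int \<Delta> a b) \<in> \<int>"
  unfolding cj_quad_int quad_int_mult by (simp add: quad_int_def algebra_simps)

text \<open>The Gram matrix of the trace form is the matrix of conjugates of the pair times its
  transpose, so its determinant is a square.\<close>

lemma trace_form_det:
  assumes "\<alpha> \<in> K" "\<beta> \<in> K"
  shows "field_trace K (\<alpha> * \<alpha>) * field_trace K (\<beta> * \<beta>) - (field_trace K (\<alpha> * \<beta>))\<^sup>2 = (\<alpha> * cj \<beta> - cj \<alpha> * \<beta>)\<^sup>2"
  using assms by (simp add: field_trace_eq K_mult cj_mult power2_eq_square algebra_simps)

lemma quad_int_det:
  "quad_int \<Delta> a b * cj (quad_int \<Delta> c d) - cj (quad_int \<Delta> a b) * quad_int \<Delta> c d = of_int (b * c - a * d) * rt"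
  unfolding cj_quad_int unfolding quad_int_eq by (simp add: field_simps)

text \<open>The basis 1, \<open>quad_int \<Delta> 0 1\<close> yields \<open>\<Delta>\<close>. Any
  other integral basis differs from it by an integer matrix of determinant 1 or -1, whose square
  does not change the value.\<close>

lemma field_disc_eq: "field_disc K = \<Delta>"
  unfolding field_disc_def
proof (rule the_equality)
  have "integral_basis K 1 (quad_int \<Delta> 0 1)"
    unfolding integral_basis_def bij_betw_def
  proof (intro conjI)
    have e: "(\<lambda>(m, n). of_int m * 1 + of_int n * quad_int \<Delta> 0 1) = (\<lambda>(m, n). quad_int \<Delta> m n)"
      by (auto simp: quad_int_def)
    show "inj (\<lambda>(m, n). of_int m * 1 + of_int n * quad_int \<Delta> 0 1)"
      unfolding e by (auto simp: inj_on_def quad_int_inject)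
    show "range (\<lambda>(m, n). of_int m * 1 + of_int n * quad_int \<Delta> 0 1) = ring_of_integers K"
      unfolding e integers_eq by auto
  qed
  moreover have one: "1 = quad_int \<Delta> 1 0" by (simp add: quad_int_def)
  have "field_trace K (1 * 1) * field_trace K (quad_int \<Delta> 0 1 * quad_int \<Delta> 0 1) - (field_trace K (1 * quad_int \<Delta> 0 1))\<^sup>2 = of_int \<Delta>"
    unfolding one trace_form_det[OF quad_int_in_K quad_int_in_K] quad_int_det using disc_pos by simp
  ultimately show "\<exists>\<alpha> \<beta>. integral_basis K \<alpha> \<beta> \<and>
     of_int \<Delta> = field_trace K (\<alpha> * \<alpha>) * field_trace K (\<beta> * \<beta>) - (field_trace K (\<alpha> * \<beta>))\<^sup>2" by metis
next
  fix D assume "\<exists>\<alpha> \<beta>. integral_basis K \<alpha> \<beta> \<and>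
     of_int D = field_trace K (\<alpha> * \<alpha>) * field_trace K (\<beta> * \<beta>) - (field_trace K (\<alpha> * \<beta>))\<^sup>2"
  then obtain \<alpha> \<beta> where ib: "integral_basis K \<alpha> \<beta>"
    and D: "of_int D = field_trace K (\<alpha> * \<alpha>) * field_trace K (\<beta> * \<beta>) - (field_trace K (\<alpha> * \<beta>))\<^sup>2" by blast
  have rg: "range (\<lambda>(m, n). of_int m * \<alpha> + of_int n * \<beta>) = {quad_int \<Delta> m n | m n. True}"
    using ib by (simp add: integral_basis_def bij_betw_def integers_eq)
  have "of_int m * \<alpha> + of_int n * \<beta> \<in> {quad_int \<Delta> m n | m n. True}" for m n
    unfolding rg[symmetric] by auto
  from this[of 1 0] this[of 0 1] obtain a b c d where ab: "\<alpha> = quad_int \<Delta> a b" and cd: "\<beta> = quad_int \<Delta> c d" by auto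
  have lin: "of_int m * \<alpha> + of_int n * \<beta> = quad_int \<Delta> (m * a + n * c) (m * b + n * d)" for m n
    unfolding ab cd by (simp add: quad_int_def algebra_simps)
  have ex: "\<exists>m n. of_int m * \<alpha> + of_int n * \<beta> = quad_int \<Delta> x y" for x y
  proof -
    have "quad_int \<Delta> x y \<in> range (\<lambda>(m, n). of_int m * \<alpha> + of_int n * \<beta>)" unfolding rg by blast
    then show ?thesis by (auto simp: eq_commute)
  qed
  \<comment> \<open>Writing 1 and \<open>quad_int \<Delta> 0 1\<close> in the given basis produces
    the inverse of the coordinate matrix, so the two integer determinants multiply to 1.\<close>
  obtain m n where mn: "m * a + n * c = 1" "m * b + n * d = 0" using ex[of 1 0] unfolding lin quad_int_inject by blast
  obtain m' n' where mn': "m' * a + n' * c = 0" "m' * b + n' * d = 1" using ex[of 0 1] unfolding lin quad_int_inject by blast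
  have "(b * c - a * d) * (n * m' - m * n') = (m * a + n * c) * (m' * b + n' * d) - (m * b + n * d) * (m' * a + n' * c)"
    by (simp add: algebra_simps)
  also have "\<dots> = 1" unfolding mn mn' by simp
  finally have "\<bar>b * c - a * d\<bar> = 1" by (metis abs_one abs_zmult_eq_1)
  then have sq: "(b * c - a * d)\<^sup>2 = 1" by (metis power2_abs one_power2)
  have "of_int D = (of_int (b * c - a * d) * rt)\<^sup>2"
    unfolding D ab cd trace_form_det[OF quad_int_in_K quad_int_in_K] quad_int_det ..
  also have "\<dots> = of_int ((b * c - a * d)\<^sup>2 * \<Delta>)" using disc_pos by (simp add: power_mult_distrib)
  finally show "D = \<Delta>" unfolding sq by simp
qed

subsection \<open>Units of orders\<close>

lemma quad_order_eq: "quad_order K f = {quad_int \<Delta> m (n * int f) | m n. True}"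
  by (auto simp: quad_order_def field_disc_eq quad_int_def)

lemma quad_order_1: "quad_order K 1 = ring_of_integers K"
  by (simp add: quad_order_eq integers_eq)

lemma quad_order_subset_integers: "quad_order K f \<subseteq> quad_order K 1"
  unfolding quad_order_1 by (auto simp: quad_order_eq integers_eq)

lemma quad_order_subset_K: "quad_order K f \<subseteq> K"
  by (auto simp: quad_order_eq quad_int_in_K)

lemma one_in_quad_order: "1 \<in> quad_order K f"
proof -
  have "1 = quad_int \<Delta> 1 (0 * int f)" by (simp add: quad_int_def)
  then show ?thesis unfolding quad_order_eq by blast
qed

lemma quad_order_mult:
  assumes "x \<in> quad_order K f" "y \<in> quad_order K f"
  shows "x * y \<in> quad_order K f"
proof -
  obtain a b c d where x: "x = quad_int \<Delta> a (b * int f)" and y: "y = quad_int \<Delta> c (d * int f)"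
    using assms unfolding quad_order_eq by blast
  have "a * (d * int f) + b * int f * c + b * int f * (d * int f) * \<Delta> = (a * d + b * c + b * d * int f * \<Delta>) * int f"
    by (simp add: algebra_simps)
  then show ?thesis unfolding x y quad_int_mult quad_order_eq by auto
qed

lemma quad_order_minus: "x \<in> quad_order K f \<Longrightarrow> - x \<in> quad_order K f"
proof -
  assume "x \<in> quad_order K f"
  then obtain a b where x: "x = quad_int \<Delta> a (b * int f)" unfolding quad_order_eq by blast
  have "- x = quad_int \<Delta> (- a) ((- b) * int f)" unfolding x by (simp add: quad_int_def)
  then show ?thesis unfolding quad_order_eq by blast
qed

lemma quad_order_cj: "x \<in> quad_order K f \<Longrightarrow> cj x \<in> quad_order K f"
proof -
  assume "x \<in> quad_order K f"
  then obtain a b where x: "x = quad_int \<Delta> a (b * int f)" unfolding quad_order_eq by blast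
  have "cj x = quad_int \<Delta> (a + b * int f * \<Delta>) ((- b) * int f)" unfolding x cj_quad_int by simp
  then show ?thesis unfolding quad_order_eq by blast
qed

lemma norm_in_Ints: "x \<in> quad_order K f \<Longrightarrow> x * cj x \<in> \<int>"
  using quad_int_mult_cj unfolding quad_order_eq by blast

text \<open>\<open>(x - cj x) / rt\<close> is the second coordinate of \<open>x\<close>, the one
  that the conductor constrains.\<close>

lemma quad_order_iff_nat_divides:
  assumes "x \<in> quad_order K 1"
  shows "x \<in> quad_order K f \<longleftrightarrow> nat_divides f ((x - cj x) / rt)"
proof
  assume "x \<in> quad_order K f"
  then obtain a b where x: "x = quad_int \<Delta> a (b * int f)" unfolding quad_order_eq by blast
  have "(x - cj x) / rt = of_int (b * int f)" unfolding x quad_int_minus_cj using disc_pos by simp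
  then show "nat_divides f ((x - cj x) / rt)" unfolding nat_divides_def by (metis dvd_triv_right)
next
  obtain a b where x: "x = quad_int \<Delta> a b" using assms unfolding quad_order_eq by auto
  have e: "(x - cj x) / rt = of_int b" unfolding x quad_int_minus_cj using disc_pos by simp
  assume "nat_divides f ((x - cj x) / rt)"
  then have "int f dvd b" unfolding e nat_divides_def by simp
  then obtain c where "b = c * int f" by (metis dvdE mult.commute)
  then show "x \<in> quad_order K f" unfolding x quad_order_eq by blast
qed

text \<open>Norms are multiplicative integers, so a unit has norm 1 or -1; conversely
  \<open>cj x\<close> or \<open>- cj x\<close> is then an inverse inside the order.\<close>

lemma order_unit_iff: "x \<in> order_units K f \<longleftrightarrow> x \<in> quad_order K f \<and> (x * cj x = 1 \<or> x * cj x = -1)"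
proof
  assume "x \<in> order_units K f"
  then obtain y where xy: "x \<in> quad_order K f" "y \<in> quad_order K f" "x * y = 1"
    by (auto simp: order_units_def units_in_def)
  have KK: "x \<in> K" "y \<in> K" using xy quad_order_subset_K by auto
  obtain a where a: "x * cj x = of_int a" using norm_in_Ints[OF xy(1)] by (elim Ints_cases)
  obtain b where b: "y * cj y = of_int b" using norm_in_Ints[OF xy(2)] by (elim Ints_cases)
  have "(x * cj x) * (y * cj y) = (x * y) * cj (x * y)" using KK by (simp add: cj_mult)
  also have "\<dots> = 1" unfolding xy(3) by (simp add: cj_rat)
  finally have "a * b = 1" unfolding a b by (metis of_int_mult of_int_eq_1_iff)
  then have "a = 1 \<or> a = -1" by (auto simp: zmult_eq_1_iff)
  then show "x \<in> quad_order K f \<and> (x * cj x = 1 \<or> x * cj x = -1)" using xy(1) a by auto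
next
  assume x: "x \<in> quad_order K f \<and> (x * cj x = 1 \<or> x * cj x = -1)"
  then have "cj x \<in> quad_order K f" "- cj x \<in> quad_order K f" by (auto intro: quad_order_cj quad_order_minus)
  moreover have "x * cj x = 1 \<or> x * (- cj x) = 1" using x by auto
  ultimately show "x \<in> order_units K f" using x unfolding order_units_def units_in_def by blast
qed

lemma order_unit_in_K: "x \<in> order_units K f \<Longrightarrow> x \<in> K"
  using order_unit_iff quad_order_subset_K by blast

lemma order_unit_nonzero: "x \<in> order_units K f \<Longrightarrow> x \<noteq> 0"
  by (auto simp: order_unit_iff)

lemma order_units_subset: "order_units K f \<subseteq> order_units K 1"
  using quad_order_subset_integers unfolding order_unit_iff subset_iff by blast

lemma order_units_iff: "x \<in> order_units K f \<longleftrightarrow> x \<in> order_units K 1 \<and> x \<in> quad_order K f"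
  using quad_order_subset_integers unfolding order_unit_iff by blast

lemma units_in_integers: "units_in (ring_of_integers K) = order_units K 1"
  unfolding order_units_def quad_order_1 ..

lemma one_in_order_units: "1 \<in> order_units K f"
  by (simp add: order_unit_iff one_in_quad_order cj_rat)

lemma order_units_mult:
  assumes "x \<in> order_units K f" "y \<in> order_units K f"
  shows "x * y \<in> order_units K f"
proof -
  have "x * y * cj (x * y) = (x * cj x) * (y * cj y)"
    unfolding cj_mult[OF order_unit_in_K[OF assms(1)] order_unit_in_K[OF assms(2)]] by (simp only: ac_simps)
  moreover have "(x * cj x) * (y * cj y) = 1 \<or> (x * cj x) * (y * cj y) = -1"
    using assms unfolding order_unit_iff by (elim conjE disjE) simp_all
  ultimately show ?thesis using assms quad_order_mult unfolding order_unit_iff by metis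
qed

lemma order_units_minus: "x \<in> order_units K f \<Longrightarrow> - x \<in> order_units K f"
  using order_unit_in_K[of x f] by (auto simp: order_unit_iff quad_order_minus cj_minus)

lemma order_units_inverse:
  assumes "x \<in> order_units K f"
  shows "inverse x \<in> order_units K f"
proof -
  obtain y where y: "x \<in> quad_order K f" "y \<in> quad_order K f" "x * y = 1"
    using assms by (auto simp: order_units_def units_in_def)
  then have "inverse x = y" "y * x = 1" using inverse_unique by (auto simp: mult.commute)
  then show ?thesis using y unfolding order_units_def units_in_def by blast
qed

lemma order_units_power: "x \<in> order_units K f \<Longrightarrow> x ^ n \<in> order_units K f"
  by (induction n) (auto intro: order_units_mult one_in_order_units)

lemma order_units_powi: "x \<in> order_units K f \<Longrightarrow> x powi n \<in> order_units K f"
  by (simp add: power_int_def order_units_power order_units_inverse)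

lemma norm_powi:
  assumes "x \<in> order_units K f"
  shows "x powi n * cj (x powi n) = (x * cj x) powi n"
proof -
  have i: "inverse x \<in> K" using order_unit_in_K[OF order_units_inverse[OF assms]] .
  have x: "x \<in> K" "x \<noteq> 0" using order_unit_in_K order_unit_nonzero assms by auto
  have "x * inverse x = 1" using x by simp
  then have "cj x * cj (inverse x) = 1" using cj_mult[OF x(1) i] by (simp add: cj_rat)
  then have "cj (inverse x) = inverse (cj x)" by (metis inverse_unique)
  then have "cj (x powi n) = cj x powi n" using x i by (simp add: power_int_def cj_power)
  then show ?thesis by (simp add: power_int_mult_distrib)
qed

text \<open>A unit above 1 has a conjugate of absolute value at most 1. So \<open>x - cj x\<close>
  and \<open>x + cj x\<close> are bounded by \<open>M + 1\<close>, and these bound first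
  \<open>b\<close> and then \<open>a\<close>.\<close>

lemma finite_units_le: "finite {x \<in> order_units K 1. 1 < x \<and> x \<le> M}"
proof -
  define B where "B = \<lceil>M + 1\<rceil> * (1 + \<Delta>)"
  have "{x \<in> order_units K 1. 1 < x \<and> x \<le> M} \<subseteq> (\<lambda>(a, b). quad_int \<Delta> a b) ` ({-B..B} \<times> {-B..B})"
  proof
    fix x assume "x \<in> {x \<in> order_units K 1. 1 < x \<and> x \<le> M}"
    then have x: "x \<in> order_units K 1" "1 < x" "x \<le> M" by auto
    obtain a b where ab: "x = quad_int \<Delta> a b" using x(1) unfolding order_unit_iff quad_order_eq by auto
    have "\<bar>x\<bar> * \<bar>cj x\<bar> = 1" using x(1) unfolding order_unit_iff by (auto simp flip: abs_mult)
    then have cx: "\<bar>cj x\<bar> \<le> 1" using x(2) by (smt (verit) mult_le_cancel_right1 abs_ge_zero)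
    define C where "C = \<lceil>M + 1\<rceil>"
    have C: "M + 1 \<le> of_int C" "C \<ge> 0" using x unfolding C_def by linarith+
    have "\<bar>of_int b * rt\<bar> \<le> M + 1" using quad_int_minus_cj[of a b] cx x unfolding ab[symmetric] by linarith
    moreover have "\<bar>of_int b\<bar> * 1 \<le> \<bar>of_int b\<bar> * rt" using rt_ge_1 by (intro mult_left_mono) auto
    ultimately have "\<bar>real_of_int b\<bar> \<le> of_int C" using C disc_pos by (simp add: abs_mult)
    then have b: "\<bar>b\<bar> \<le> C" by linarith
    have "\<bar>real_of_int (2 * a + b * \<Delta>)\<bar> \<le> of_int C" using quad_int_plus_cj[of a b] cx x C unfolding ab[symmetric] by linarith
    then have "\<bar>2 * a + b * \<Delta>\<bar> \<le> C" by linarith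
    moreover have "\<bar>b * \<Delta>\<bar> \<le> C * \<Delta>" using b disc_pos by (simp add: abs_mult)
    moreover have CD: "C * \<Delta> \<ge> 0" using C disc_pos by simp
    ultimately have "\<bar>a\<bar> \<le> C + C * \<Delta>" by linarith
    then have "a \<in> {-B..B}" "b \<in> {-B..B}" using b CD unfolding B_def C_def[symmetric] by (auto simp: algebra_simps)
    then show "x \<in> (\<lambda>(a, b). quad_int \<Delta> a b) ` ({-B..B} \<times> {-B..B})" using ab by force
  qed
  then show ?thesis by (rule finite_subset) auto
qed

text \<open>A Pell solution for \<open>\<Delta>\<close> itself. It provides the witness that both
  fundamental units need in order to exist as minima.\<close>

lemma norm_one_unit_exists: "\<exists>x\<in>order_units K 1. x * cj x = 1 \<and> 1 < x"
proof -
  obtain x y :: int where xy: "x > 0" "y > 0" "x\<^sup>2 - \<Delta> * y\<^sup>2 = 1"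
    using pell_solution_exists[OF irrational disc_pos] by blast
  define z where "z = of_int x + of_int y * rt"
  have z: "z = quad_int \<Delta> (x - y * \<Delta>) ((2 * y) * int 1)" by (simp add: z_def quad_int_def field_simps)
  have O: "z \<in> quad_order K 1" unfolding quad_order_eq using z by blast
  have "z * cj z = (of_int x + of_int y * rt) * (of_int x - of_int y * rt)"
    unfolding z_def by (subst cj_eq) auto
  also have "\<dots> = of_int x * of_int x - of_int y * of_int y * (rt * rt)" by (simp only: algebra_simps)
  also have "\<dots> = of_int (x\<^sup>2 - \<Delta> * y\<^sup>2)" unfolding rt_square by (simp add: power2_eq_square)
  finally have n: "z * cj z = 1" unfolding xy by simp
  have "of_int y * rt > 0" using xy disc_pos by simp
  moreover have "real_of_int x \<ge> 1" using xy by simp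
  ultimately have "z > 1" unfolding z_def by linarith
  then show ?thesis using O n by (auto simp: order_unit_iff)
qed

section \<open>The fundamental units and their powers\<close>

abbreviation u where "u \<equiv> fund_unit K"
abbreviation e where "e \<equiv> pos_fund_unit K"

lemma fund_unit:
  shows "u \<in> order_units K 1" "u > 1" "\<And>x. x \<in> order_units K 1 \<Longrightarrow> x > 1 \<Longrightarrow> u \<le> x"
proof -
  let ?P = "\<lambda>x. x \<in> order_units K 1 \<and> x > 1"
  obtain x where x: "?P x" using norm_one_unit_exists by blast
  have f: "finite {y. ?P y \<and> y \<le> x}"
    by (rule finite_subset[OF _ finite_units_le[of x]]) auto
  have "u = Least ?P" unfolding fund_unit_def units_in_integers ..
  then show "u \<in> order_units K 1" "u > 1" "\<And>x. x \<in> order_units K 1 \<Longrightarrow> x > 1 \<Longrightarrow> u \<le> x"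
    using Least_discrete[of ?P, OF x f] by auto
qed

lemma pos_fund_unit:
  shows "e \<in> order_units K 1" "e > 1" "e * cj e = 1"
    "\<And>x. x \<in> order_units K 1 \<Longrightarrow> x > 1 \<Longrightarrow> x * cj x = 1 \<Longrightarrow> e \<le> x"
proof -
  let ?P = "\<lambda>x. x \<in> order_units K 1 \<and> field_norm K x = 1 \<and> x > 1"
  have n: "field_norm K x = x * cj x" if "x \<in> order_units K 1" for x
    using that by (simp add: field_norm_eq order_unit_in_K)
  obtain x where x: "?P x" using norm_one_unit_exists n by metis
  have f: "finite {y. ?P y \<and> y \<le> x}"
    by (rule finite_subset[OF _ finite_units_le[of x]]) auto
  have "e = Least ?P" unfolding pos_fund_unit_def units_in_integers ..
  then show "e \<in> order_units K 1" "e > 1" "e * cj e = 1"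
    "\<And>x. x \<in> order_units K 1 \<Longrightarrow> x > 1 \<Longrightarrow> x * cj x = 1 \<Longrightarrow> e \<le> x"
    using Least_discrete[of ?P, OF x f] n by auto
qed

text \<open>Dividing \<open>x\<close> by the largest power of \<open>u\<close> not exceeding it
  leaves a unit in the interval from 1 up to but excluding \<open>u\<close>; minimality of
  \<open>u\<close> makes it 1.\<close>

lemma pos_unit_eq_powi:
  assumes "x \<in> order_units K 1" "x > 0"
  shows "\<exists>n. x = u powi n"
proof -
  define n where "n = \<lfloor>log u x\<rfloor>"
  have u: "u > 1" "u \<noteq> 0" using fund_unit(2) by auto
  have "u powi n = u powr (of_int n)" using u by (simp add: powr_real_of_int')
  also have "\<dots> \<le> x" using assms(2) u by (simp add: n_def le_log_iff[symmetric])
  finally have lo: "u powi n \<le> x" .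
  have "x < u powr (of_int (n + 1))" using assms(2) u unfolding n_def by (subst log_less_iff[symmetric]) linarith+
  also have "\<dots> = u powi (n + 1)" using u powr_real_of_int'[of u "n + 1"] by simp
  also have "\<dots> = u powi n * u" using u by (simp add: power_int_add)
  finally have hi: "x < u powi n * u" .
  have p: "u powi n > 0" using u by simp
  define y where "y = x * inverse (u powi n)"
  have "y \<in> order_units K 1" unfolding y_def
    using assms(1) fund_unit(1) by (intro order_units_mult order_units_inverse order_units_powi)
  moreover have "1 \<le> y" "y < u" using lo hi p by (simp_all add: y_def field_simps)
  ultimately have "y = 1" using fund_unit(3)[of y] by force
  then show ?thesis using p by (auto simp: y_def field_simps)
qed

lemma unit_eq_powi:
  assumes "x \<in> order_units K 1"
  obtains n where "x = u powi n \<or> x = - (u powi n)"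
proof (cases "x > 0")
  case True
  then show ?thesis using pos_unit_eq_powi[OF assms] that by blast
next
  case False
  then have "- x > 0" using order_unit_nonzero[OF assms] by simp
  then obtain n where "- x = u powi n" using pos_unit_eq_powi[OF order_units_minus[OF assms]] by blast
  then have "x = - (u powi n)" by simp
  then show ?thesis using that by blast
qed

lemma norm_minus: "x \<in> K \<Longrightarrow> - x * cj (- x) = x * cj x"
  by (simp add: cj_minus)

lemma norm_fund_unit_powi:
  assumes "u * cj u = -1"
  shows "u powi n * cj (u powi n) = (if even n then 1 else -1)"
  unfolding norm_powi[OF fund_unit(1)] assms by (rule minus_one_powi)

text \<open>If \<open>u\<close> had norm 1, so would all its powers and their negatives, and these
  are all the units.\<close>

lemma norm_fund_unit_of_norm_minus_one:
  assumes "x \<in> order_units K 1" "x * cj x = -1"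
  shows "u * cj u = -1"
proof (rule ccontr)
  assume "u * cj u \<noteq> -1"
  then have u: "u * cj u = 1" using fund_unit(1) unfolding order_unit_iff by blast
  obtain n where n: "x = u powi n \<or> x = - (u powi n)" using unit_eq_powi[OF assms(1)] .
  have "u powi n \<in> K" using order_unit_in_K[OF order_units_powi[OF fund_unit(1)]] .
  then have "x * cj x = u powi n * cj (u powi n)" using n norm_minus by auto
  also have "\<dots> = 1" unfolding norm_powi[OF fund_unit(1)] u by simp
  finally show False using assms(2) by simp
qed

text \<open>\<open>e\<close> is a power of \<open>u\<close>; norm 1 makes the exponent even and
  \<open>e > 1\<close> makes it positive, so it is at least 2. The square of \<open>u\<close> is
  itself a candidate for \<open>e\<close>.\<close>

lemma pos_fund_unit_eq_square:
  assumes "u * cj u = -1"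
  shows "e = u\<^sup>2"
proof (rule antisym)
  have "u\<^sup>2 * cj (u\<^sup>2) = 1" using norm_fund_unit_powi[OF assms, of 2] by simp
  moreover have "u\<^sup>2 > 1" using fund_unit(2) by (simp add: one_less_power)
  ultimately show "e \<le> u\<^sup>2" using pos_fund_unit(4) order_units_power[OF fund_unit(1)] by blast
  obtain n where n: "e = u powi n" using pos_unit_eq_powi[OF pos_fund_unit(1)] pos_fund_unit(2) by auto
  have "even n" using pos_fund_unit(3) norm_fund_unit_powi[OF assms, of n] unfolding n by (auto split: if_splits)
  moreover have "n > 0"
  proof (rule ccontr)
    assume "\<not> n > 0"
    then have "u powi n \<le> u powi 0" using fund_unit(2) by (intro power_int_increasing) auto
    then show False using pos_fund_unit(2) unfolding n by simp
  qed
  ultimately have "n \<ge> 2" by presburger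
  then have "u powi 2 \<le> u powi n" using fund_unit(2) by (intro power_int_increasing) auto
  then show "u\<^sup>2 \<le> e" unfolding n by simp
qed

section \<open>The sequences \<open>f_seq\<close> and \<open>d_seq\<close>, and the exponents of
  units in an order\<close>

lemma f_seq_eq: "f_seq K j = (e ^ j - cj (e ^ j)) / rt"
proof -
  have "cj e = inverse e" using pos_fund_unit(3) by (metis inverse_unique)
  then have "cj (e ^ j) = inverse e ^ j" using cj_power[OF order_unit_in_K[OF pos_fund_unit(1)]] by simp
  then show ?thesis by (simp add: f_seq_def field_disc_eq)
qed

text \<open>Turns the divisibility that defines \<open>j_min\<close> into membership of a power of
  \<open>e\<close> in the order.\<close>

lemma nat_divides_f_seq: "nat_divides f (f_seq K j) \<longleftrightarrow> e ^ j \<in> quad_order K f"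
proof -
  have "e ^ j \<in> quad_order K 1" using order_units_power[OF pos_fund_unit(1)] unfolding order_unit_iff by blast
  then show ?thesis using quad_order_iff_nat_divides f_seq_eq by simp
qed

text \<open>For \<open>v = sqrt e\<close> the hypothesis makes \<open>v - inverse v\<close> an
  integer, while \<open>v + inverse v\<close> is a rational multiple of \<open>rt\<close>. So
  \<open>v\<close> lies in \<open>K\<close>, has conjugate \<open>- inverse v\<close>, and is a unit
  of norm -1.\<close>

lemma norm_fund_unit_of_perfect_square:
  assumes "perfect_square (d_seq K 1 - 3)"
  shows "u * cj u = -1"
proof -
  obtain k where "e + inverse e - 2 = of_int (k\<^sup>2)"
    using assms by (auto simp: perfect_square_def d_seq_def is_nth_power_def)
  define v where "v = sqrt e"
  \<comment> \<open>Only the square of \<open>k\<close> is known; since \<open>v - inverse v\<close>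
    is positive, it equals the absolute value.\<close>
  define a where "a = real_of_int \<bar>k\<bar>"
  have v: "v > 1" "v * v = e" using pos_fund_unit(2) by (auto simp: v_def)
  have "(v - inverse v)\<^sup>2 = e + inverse e - 2"
    using v by (simp add: power2_eq_square algebra_simps flip: v(2))
  also have "\<dots> = a\<^sup>2" using \<open>e + inverse e - 2 = _\<close> by (simp add: a_def)
  finally have "(v - inverse v)\<^sup>2 = a\<^sup>2" .
  moreover have vi: "inverse v < 1" using v by (simp add: inverse_less_1_iff)
  ultimately have a: "v - inverse v = a" using v power2_eq_iff_nonneg[of "v - inverse v" a] a_def by simp
  then have a0: "a > 0" using vi v by linarith
  obtain c b where cb: "e = quad_int \<Delta> c b" using pos_fund_unit(1) unfolding order_unit_iff quad_order_eq by auto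
  have "cj e = inverse e" using pos_fund_unit(3) by (metis inverse_unique)
  \<comment> \<open>\<open>e - inverse e\<close> is an integer multiple of \<open>rt\<close>;
    dividing by \<open>v - inverse v = a\<close> determines \<open>v + inverse v\<close>, and half
    the sum of the two is \<open>v\<close>.\<close>
  then have "e - inverse e = of_int b * rt" using quad_int_minus_cj[of c b] cb by simp
  moreover have "e - inverse e = (v + inverse v) * (v - inverse v)"
    using v by (simp add: algebra_simps flip: v(2))
  ultimately have "(v + inverse v) * a = of_int b * rt" using a by simp
  then have sum: "v + inverse v = of_int b / a * rt" using a0 by (simp add: nonzero_eq_divide_eq)
  have v_eq: "v = a / 2 + (of_int b / (2 * a)) * rt" using a sum by (simp add: field_simps)
  have rat: "a / 2 \<in> \<rat>" "of_int b / (2 * a) \<in> \<rat>" by (auto simp: a_def)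
  have vK: "v \<in> K" unfolding v_eq using rat by (rule K_I)
  have "cj v = a / 2 - (of_int b / (2 * a)) * rt" unfolding v_eq using rat by (rule cj_eq)
  also have "\<dots> = - inverse v" using a sum by (simp add: field_simps)
  finally have cv: "v * cj v = -1" using v by simp
  \<comment> \<open>The monic equation with trace \<open>\<bar>k\<bar>\<close> and norm -1, which
    shows that \<open>v\<close> is integral.\<close>
  have "v\<^sup>2 = of_int \<bar>k\<bar> * v - of_int (-1)"
  proof -
    have "v * (v - inverse v) = v * a" using a by simp
    then show ?thesis using v(1) by (simp add: a_def power2_eq_square algebra_simps)
  qed
  then have "algebraic_int v" by (rule algebraic_int_quadratic)
  then have "v \<in> quad_order K 1" using vK unfolding quad_order_1 ring_of_integers_def by blast
  then have "v \<in> order_units K 1" using cv unfolding order_unit_iff by blast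
  then show ?thesis using cv by (rule norm_fund_unit_of_norm_minus_one)
qed

text \<open>With \<open>e = u\<^sup>2\<close> the number is the square of
  \<open>u - inverse u\<close>, which is the trace of \<open>u\<close> because
  \<open>cj u = - inverse u\<close>.\<close>

lemma perfect_square_of_norm_fund_unit:
  assumes "u * cj u = -1"
  shows "perfect_square (d_seq K 1 - 3)"
proof -
  have u: "u > 0" using fund_unit(2) by simp
  have cu: "cj u = - inverse u" using assms u by (simp add: field_simps)
  obtain a b where ab: "u = quad_int \<Delta> a b" using fund_unit(1) unfolding order_unit_iff quad_order_eq by auto
  have "d_seq K 1 - 3 = (u - inverse u)\<^sup>2"
    unfolding d_seq_def pos_fund_unit_eq_square[OF assms] using u by (simp add: power2_eq_square algebra_simps)
  also have "u - inverse u = of_int (2 * a + b * \<Delta>)" using quad_int_plus_cj[of a b] cu ab by simp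
  finally have "d_seq K 1 - 3 = of_int ((2 * a + b * \<Delta>)\<^sup>2)" by simp
  then show ?thesis unfolding perfect_square_def is_nth_power_def by blast
qed

text \<open>For odd \<open>j\<close>, \<open>x = u ^ j\<close> has norm -1, so
  \<open>x - cj x = x + inverse x\<close>. Then \<open>d_seq K j + 1\<close> and
  \<open>d_seq K j - 3\<close> are the squares of \<open>x + inverse x\<close> and
  \<open>x - inverse x\<close>, and the numerator of \<open>f_seq K j\<close> is the product of
  these two.\<close>

lemma sqrt_d_seq:
  assumes "u * cj u = -1" "odd j"
  shows "sqrt ((d_seq K j + 1) / of_int \<Delta>) = (u ^ j - cj (u ^ j)) / rt"
    "f_seq K j / sqrt (d_seq K j - 3) = (u ^ j - cj (u ^ j)) / rt"
    "(u ^ j - cj (u ^ j)) / rt \<in> \<int>"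
proof -
  define x where "x = u ^ j"
  have j0: "j > 0" using assms(2) by (rule odd_pos)
  have x1: "x > 1" unfolding x_def using fund_unit(2) j0 by (rule one_less_power)
  have "x * cj x = -1" using norm_fund_unit_powi[OF assms(1), of "int j"] assms(2) by (simp add: x_def)
  then have cx: "cj x = - inverse x" using x1 by (simp add: field_simps)
  have ej: "e ^ j = x * x" unfolding pos_fund_unit_eq_square[OF assms(1)] x_def by (simp add: power2_eq_square power_mult_distrib)
  have ej': "inverse e ^ j = inverse x * inverse x" using ej by (simp add: power_inverse)
  \<comment> \<open>Positivity selects the right square roots; the second inequality also permits
    cancelling \<open>x - inverse x\<close>.\<close>
  have pos: "x + inverse x > 0" "x - inverse x > 0"
    using x1 inverse_less_1_iff[of x] by (auto intro: add_pos_pos)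
  have "d_seq K j + 1 = (x + inverse x)\<^sup>2"
    unfolding d_seq_def ej ej' using x1 by (simp add: power2_eq_square algebra_simps)
  then show "sqrt ((d_seq K j + 1) / of_int \<Delta>) = (u ^ j - cj (u ^ j)) / rt"
    unfolding x_def[symmetric] cx using pos by (simp add: real_sqrt_divide)
  have "d_seq K j - 3 = (x - inverse x)\<^sup>2"
    unfolding d_seq_def ej ej' using x1 by (simp add: power2_eq_square algebra_simps)
  then have "sqrt (d_seq K j - 3) = x - inverse x" using pos by simp
  moreover have "f_seq K j = (x + inverse x) * (x - inverse x) / rt"
    unfolding f_seq_def field_disc_eq ej ej' by (simp add: algebra_simps)
  ultimately show "f_seq K j / sqrt (d_seq K j - 3) = (u ^ j - cj (u ^ j)) / rt"
    unfolding x_def[symmetric] cx using pos by simp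
  have "x \<in> order_units K 1" unfolding x_def using order_units_power[OF fund_unit(1)] .
  then obtain a b where ab: "x = quad_int \<Delta> a b" unfolding order_unit_iff quad_order_eq by auto
  show "(u ^ j - cj (u ^ j)) / rt \<in> \<int>"
    unfolding x_def[symmetric] ab quad_int_minus_cj using disc_pos by simp
qed

text \<open>The exponents \<open>n\<close> with \<open>u powi n\<close> in the order form a subgroup
  \<open>G\<close> of the integers, and the unit of norm -1 puts an odd number into it. So the
  generator of \<open>G\<close> is odd, and being half the least positive even element it equals
  \<open>j_min K f\<close>.\<close>

lemma powi_in_order_units_iff_dvd:
  assumes "x \<in> order_units K f" "x * cj x = -1"
  shows "odd (j_min K f)" "u powi n \<in> order_units K f \<longleftrightarrow> int (j_min K f) dvd n"
proof -
  have nu: "u * cj u = -1" using norm_fund_unit_of_norm_minus_one assms order_units_subset by blast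
  have u0: "u \<noteq> 0" using fund_unit(2) by simp
  define G where "G = {n. u powi n \<in> order_units K f}"
  have Gadd: "a + b \<in> G" if "a \<in> G" "b \<in> G" for a b
    using that u0 by (simp add: G_def power_int_add order_units_mult)
  have Gneg: "- a \<in> G" if "a \<in> G" for a
    using that by (simp add: G_def power_int_minus order_units_inverse)
  have Gmult: "a * b \<in> G" if "a \<in> G" for a b
    using order_units_powi[of "u powi a" f b] that by (simp add: G_def power_int_mult)
  have Gmod: "a mod b \<in> G" if "a \<in> G" "b \<in> G" for a b
    using Gadd[OF that(1) Gneg[OF Gmult[OF that(2), of "a div b"]]] by (simp add: minus_mult_div_eq_mod)
  \<comment> \<open>Since \<open>e = u\<^sup>2\<close>, the index \<open>j\<close> of
    \<open>f_seq\<close> corresponds to the exponent \<open>2 * j\<close>: \<open>j_min\<close> sees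
    only the even elements of \<open>G\<close>.\<close>
  have f_iff: "nat_divides f (f_seq K j) \<longleftrightarrow> 2 * int j \<in> G" for j
  proof -
    have "e ^ j = u powi (2 * int j)"
      unfolding pos_fund_unit_eq_square[OF nu] by (simp add: power_int_mult)
    then show ?thesis
      unfolding nat_divides_f_seq G_def order_units_iff[of _ f] using order_units_powi[OF fund_unit(1)] by simp
  qed
  obtain k where k: "x = u powi k \<or> x = - (u powi k)" using unit_eq_powi assms(1) order_units_subset by blast
  have kG: "k \<in> G" using k assms(1) order_units_minus[of x f] by (auto simp: G_def)
  have "u powi k \<in> K" using order_unit_in_K[OF order_units_powi[OF fund_unit(1)]] .
  then have "u powi k * cj (u powi k) = -1" using k assms(2) norm_minus[of "u powi k"] by auto
  then have k_odd: "odd k" using norm_fund_unit_powi[OF nu, of k] by (auto split: if_splits)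
  define m where "m = int (j_min K f)"
  \<comment> \<open>An admissible index is needed before \<open>LeastI\<close> applies.
    \<open>\<bar>k\<bar>\<close> is one, and it is positive because \<open>k\<close> is odd.\<close>
  have "2 * int (nat \<bar>k\<bar>) \<in> G" using Gmult[OF kG, of 2] Gneg[OF Gmult[OF kG, of 2]] by (auto simp: abs_if mult.commute)
  moreover have "nat \<bar>k\<bar> \<ge> 1" using k_odd by (cases "k = 0") auto
  ultimately have "nat \<bar>k\<bar> \<ge> 1 \<and> nat_divides f (f_seq K (nat \<bar>k\<bar>))" using f_iff by simp
  then have "j_min K f \<ge> 1 \<and> nat_divides f (f_seq K (j_min K f))" unfolding j_min_def by (rule LeastI)
  then have m: "m \<ge> 1" "2 * m \<in> G" using f_iff by (auto simp: m_def)
  \<comment> \<open>Doubling a positive element of \<open>G\<close> gives an even one, so the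
    element itself is an admissible index for \<open>j_min\<close>.\<close>
  have min: "m \<le> j" if "j \<in> G" "j > 0" for j
  proof -
    have "nat j \<ge> 1 \<and> nat_divides f (f_seq K (nat j))"
      using f_iff[of "nat j"] Gmult[OF that(1), of 2] that(2) by (simp add: mult.commute)
    then have "j_min K f \<le> nat j" unfolding j_min_def by (rule Least_le)
    then show ?thesis using that(2) by (simp add: m_def)
  qed
  \<comment> \<open>The residue of the odd exponent \<open>k\<close> modulo \<open>2 m\<close> and its negative are both in \<open>G\<close>,
    so minimality leaves \<open>m\<close> as the only possible value.\<close>
  define r where "r = k mod (2 * m)"
  have r: "r \<in> G" unfolding r_def using kG m(2) by (rule Gmod)
  have r_odd: "odd r" unfolding r_def using k_odd by (simp add: even_mod_2_iff odd_iff_mod_2_eq_one mod_mod_cancel)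
  have "r \<ge> 0" "r < 2 * m" using m(1) by (auto simp: r_def)
  moreover have "r \<noteq> 0" using r_odd by auto
  ultimately have rb: "0 < r" "r < 2 * m" by auto
  have "2 * m - r \<in> G" using Gadd[OF m(2) Gneg[OF r]] by simp
  then have "m \<le> 2 * m - r" using rb by (intro min) auto
  then have "r = m" using min[OF r rb(1)] by simp
  then have mG: "m \<in> G" and "odd m" using r r_odd by auto
  then show "odd (j_min K f)" by (simp add: m_def)
  show "u powi n \<in> order_units K f \<longleftrightarrow> int (j_min K f) dvd n"
  proof
    assume "u powi n \<in> order_units K f"
    then have "n mod m \<in> G" using mG by (intro Gmod) (simp_all add: G_def)
    moreover have "0 \<le> n mod m" "n mod m < m" using m(1) by auto
    ultimately have "n mod m = 0" using min[of "n mod m"] by force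
    then show "int (j_min K f) dvd n" by (simp add: m_def dvd_eq_mod_eq_0)
  next
    assume "int (j_min K f) dvd n"
    then have "n \<in> G" using Gmult[OF mG] by (auto simp: m_def elim!: dvdE)
    then show "u powi n \<in> order_units K f" by (simp add: G_def)
  qed
qed

text \<open>In both directions the unit that matters is \<open>u ^ j_min K f\<close>: the
  divisibility condition says that it lies in the order, and the parity of its exponent gives norm
  -1.\<close>

lemma norm_minus_one_unit_iff:
  "(\<exists>x\<in>order_units K f. field_norm K x = -1) \<longleftrightarrow>
    perfect_square (d_seq K 1 - 3) \<and> odd (j_min K f) \<and>
    nat_divides f (sqrt ((d_seq K (j_min K f) + 1) / of_int \<Delta>))"
proof
  assume "\<exists>x\<in>order_units K f. field_norm K x = -1"
  then obtain x where x: "x \<in> order_units K f" "x * cj x = -1" using field_norm_eq order_unit_in_K by metis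
  have nu: "u * cj u = -1" using norm_fund_unit_of_norm_minus_one x order_units_subset by blast
  have od: "odd (j_min K f)" using powi_in_order_units_iff_dvd(1)[OF x] .
  have "u ^ j_min K f \<in> order_units K f" using powi_in_order_units_iff_dvd(2)[OF x, of "int (j_min K f)"] by simp
  then have "nat_divides f ((u ^ j_min K f - cj (u ^ j_min K f)) / rt)"
    using quad_order_iff_nat_divides order_units_iff order_unit_iff by blast
  then show "perfect_square (d_seq K 1 - 3) \<and> odd (j_min K f) \<and>
    nat_divides f (sqrt ((d_seq K (j_min K f) + 1) / of_int \<Delta>))"
    using perfect_square_of_norm_fund_unit[OF nu] od sqrt_d_seq(1)[OF nu od] by simp
next
  assume R: "perfect_square (d_seq K 1 - 3) \<and> odd (j_min K f) \<and>
    nat_divides f (sqrt ((d_seq K (j_min K f) + 1) / of_int \<Delta>))"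
  then have nu: "u * cj u = -1" using norm_fund_unit_of_perfect_square by blast
  define x where "x = u ^ j_min K f"
  have x1: "x \<in> order_units K 1" unfolding x_def using order_units_power[OF fund_unit(1)] .
  have "nat_divides f ((x - cj x) / rt)" using R sqrt_d_seq(1)[OF nu, of "j_min K f"] by (simp add: x_def)
  then have "x \<in> order_units K f" using x1 quad_order_iff_nat_divides order_units_iff order_unit_iff by blast
  moreover have "x * cj x = -1" using norm_fund_unit_powi[OF nu, of "int (j_min K f)"] R by (simp add: x_def)
  ultimately show "\<exists>x\<in>order_units K f. field_norm K x = -1" using field_norm_eq order_unit_in_K by metis
qed

text \<open>Every unit is a power of \<open>u\<close> up to sign, and the sign does not affect
  membership in the order; the subgroup of exponents is generated by
  \<open>j_min K f\<close>.\<close>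

lemma order_units_eq:
  assumes "\<exists>x\<in>order_units K f. field_norm K x = -1"
  shows "order_units K f = {s * u powi (n * int (j_min K f)) | (s::real) (n::int). s = 1 \<or> s = -1}"
proof (intro equalityI subsetI)
  obtain x where x: "x \<in> order_units K f" "x * cj x = -1" using assms field_norm_eq order_unit_in_K by metis
  note G = powi_in_order_units_iff_dvd(2)[OF x]
  {
    fix y assume y: "y \<in> order_units K f"
    then obtain n where n: "y = u powi n \<or> y = - (u powi n)" using unit_eq_powi order_units_subset by blast
    then have "u powi n \<in> order_units K f" using y order_units_minus[OF y] by auto
    then obtain l where "n = l * int (j_min K f)" unfolding G by (metis dvdE mult.commute)
    then have "y = 1 * u powi (l * int (j_min K f)) \<or> y = (-1) * u powi (l * int (j_min K f))" using n by simp
    then show "y \<in> {s * u powi (n * int (j_min K f)) | (s::real) (n::int). s = 1 \<or> s = -1}" by blast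
  next
    fix y assume "y \<in> {s * u powi (n * int (j_min K f)) | (s::real) (n::int). s = 1 \<or> s = -1}"
    then obtain s n where y: "y = s * u powi (n * int (j_min K f))" "s = 1 \<or> s = -1" by blast
    have "u powi (n * int (j_min K f)) \<in> order_units K f" unfolding G by simp
    then show "y \<in> order_units K f" using y order_units_minus by auto
  }
qed

end

text \<open>The first conjunct records that the number tested for divisibility is an integer and
  that its two expressions agree. Both rest on \<open>u\<close> having norm -1, which the square
  condition supplies.\<close>

theorem theorem4p15:
  fixes K :: "real set" and f :: nat
  assumes "real_quadratic_field K" and "f > 0"
  shows
    "(perfect_square (d_seq K 1 - 3) \<and> odd (j_min K f) \<longrightarrow>
        sqrt ((d_seq K (j_min K f) + 1) / of_int (field_disc K)) \<in> \<int> \<and>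
        sqrt ((d_seq K (j_min K f) + 1) / of_int (field_disc K))
          = f_seq K (j_min K f) / sqrt (d_seq K (j_min K f) - 3)) \<and>
     ((\<exists>x\<in>order_units K f. field_norm K x = -1) \<longleftrightarrow>
        perfect_square (d_seq K 1 - 3) \<and> odd (j_min K f) \<and>
        nat_divides f (sqrt ((d_seq K (j_min K f) + 1) / of_int (field_disc K)))) \<and>
     ((\<exists>x\<in>order_units K f. field_norm K x = -1) \<longrightarrow>
        order_units K f =
          {s * fund_unit K powi (n * int (j_min K f)) | (s::real) (n::int). s = 1 \<or> s = -1})"
proof -
  obtain \<Delta> :: int where "\<Delta> > 0" "sqrt (of_int \<Delta>) \<notin> \<rat>" "4 dvd \<Delta>\<^sup>2 - \<Delta>"
    "K = {p + q * sqrt (of_int \<Delta>) | p q. p \<in> \<rat> \<and> q \<in> \<rat>}"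
    "ring_of_integers K = {quad_int \<Delta> m n | m n. True}"
    using real_quadratic_field_structure[OF assms(1)] .
  then interpret quadratic_field K \<Delta> by unfold_locales
  show ?thesis
    unfolding field_disc_eq
    using norm_minus_one_unit_iff[of f] order_units_eq[of f] norm_fund_unit_of_perfect_square
      sqrt_d_seq[of "j_min K f"] by auto
qed

end
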